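(* Let $X,Y$ be Hilbert spaces, $A:X\to Y$ a bounded linear operator with $\|A^*A\|<1$, let $\beta>-1$, and suppose that the source condition $x^\dagger=(A^*A)^\mu\omega$ holds with some $\mu>0$ and some $\omega\in X$. For noisy data $y^\delta\in Y$ with $\|Ax^\dagger-y^\delta\|=\delta$, let $x_k^\delta$ be the iterates of the Nesterov iteration with $\alpha_k=\frac{k-1}{k+\beta}$, and let the iteration be stopped by the discrepancy principle, i.e. let $k(\delta)$ be the smallest $k$ such that $$\|Ax_k^\delta-y^\delta\|\le\tau\delta,$$ where $\tau>1$ is fixed. Then the following holds as $\delta\to0$. 1. If $\mu+\frac12\le\frac{\beta+1}{4}$, then $$\|x_{k(\delta)}^\delta-x^\dagger\|=O\left(\delta^{\frac{2\mu}{2\mu+1}}\right),\qquad\text{with } k(\delta)=O\left(\delta^{-\frac{1}{2\mu+1}}\right).$$ 2. If $\mu+\frac12\ge\frac{\beta+1}{4}$, then $$k(\delta)=O\left(\delta^{-\frac{1}{\frac12+\mu+\frac{\beta+1}{4}}}\right)\quad\text{and}\quad \|x_{k(\delta)}^\delta-x^\dagger\|=O\left(\delta^{\frac{\mu+\frac{\beta+1}{4}-\frac12}{\mu+\frac{\beta+1}{4}+\frac12}}\right).$$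
   Context: The Nesterov iteration with data $y^\delta$ is $$x_0^\delta=0,\quad x_1^\delta=A^*y^\delta,\quad z_k^\delta=x_k^\delta+\alpha_k(x_k^\delta-x_{k-1}^\delta),\quad x_{k+1}^\delta=z_k^\delta+A^*(y^\delta-Az_k^\delta),\qquad k\ge 1.$$ The element $x^\dagger\in X$ is the minimum-norm solution of $Ax=y$ with exact data $y=Ax^\dagger$ (i.e. $x^\dagger\in\ker(A)^\perp$). For each noise level $\delta>0$, $y^\delta$ denotes noisy data with $\|Ax^\dagger-y^\delta\|=\delta$. The power $(A^*A)^\mu$ is defined by the spectral functional calculus. *)

theory Defs
  imports
    "HOL-Analysis.Analysis"
    "HOL-Computational_Algebra.Polynomial"
    "HOL-Library.Landau_Symbols"
begin

(* Hilbert spaces are types of sort {real_inner, complete_space}, operators are functions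
   satisfying bounded_linear, the operator norm is onorm, and the Hilbert space adjoint is
   the library's adjoint (well-defined for bounded operators by the Riesz theorem). *)

definition min_norm_solution ::
    "('a::real_inner \<Rightarrow> 'b::real_inner) \<Rightarrow> 'b \<Rightarrow> 'a \<Rightarrow> bool" where
  "min_norm_solution A y x \<longleftrightarrow> A x = y \<and> (\<forall>x'. A x' = y \<longrightarrow> norm x \<le> norm x')"

(* For a self-adjoint T the spectrum is real, so real t suffice. *)
definition op_spectrum :: "('a::real_inner \<Rightarrow> 'a) \<Rightarrow> real set" where
  "op_spectrum T = {t. \<not> (\<exists>S. bounded_linear S
      \<and> (\<forall>x. S (T x - t *\<^sub>R x) = x) \<and> (\<forall>x. T (S x) - t *\<^sub>R S x = x))}"

definition poly_op :: "real poly \<Rightarrow> ('a::real_inner \<Rightarrow> 'a) \<Rightarrow> 'a \<Rightarrow> 'a" where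
  "poly_op p T x = (\<Sum>i\<le>degree p. coeff p i *\<^sub>R (T ^^ i) x)"

(* The spectral functional calculus f(T) of a bounded self-adjoint operator T for a function
   f that is continuous on the spectrum: the operator-norm limit of p n (T) for all
   sequences of polynomials p n converging to f uniformly on the spectrum.  By the
   Weierstrass theorem and norm (p(T)) = sup |p| on the spectrum, this determines f(T)
   uniquely.  The value is unspecified for other T or f. *)
definition functional_calculus ::
    "(real \<Rightarrow> real) \<Rightarrow> ('a::{real_inner,complete_space} \<Rightarrow> 'a) \<Rightarrow> 'a \<Rightarrow> 'a" where
  "functional_calculus f T = (THE B. bounded_linear B \<and>
     (\<forall>p :: nat \<Rightarrow> real poly.
        uniform_limit (op_spectrum T) (\<lambda>n. poly (p n)) f sequentially \<longrightarrow>
        (\<lambda>n. onorm (\<lambda>x. poly_op (p n) T x - B x)) \<longlonglongrightarrow> 0))"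

(* Intended for positive T and \<mu> > 0; then 0 powr \<mu> = 0 is the continuous value at 0. *)
definition op_powr :: "('a::{real_inner,complete_space} \<Rightarrow> 'a) \<Rightarrow> real \<Rightarrow> 'a \<Rightarrow> 'a" where
  "op_powr T \<mu> = functional_calculus (\<lambda>t. t powr \<mu>) T"

fun nesterov ::
    "('a::real_inner \<Rightarrow> 'b::real_inner) \<Rightarrow> (nat \<Rightarrow> real) \<Rightarrow> 'b \<Rightarrow> nat \<Rightarrow> 'a" where
  "nesterov A \<alpha> y 0 = 0"
| "nesterov A \<alpha> y (Suc 0) = adjoint A y"
| "nesterov A \<alpha> y (Suc (Suc k)) =
     (let z = nesterov A \<alpha> y (Suc k)
            + \<alpha> (Suc k) *\<^sub>R (nesterov A \<alpha> y (Suc k) - nesterov A \<alpha> y k)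
      in z + adjoint A (y - A z))"

definition nesterov_weight :: "real \<Rightarrow> nat \<Rightarrow> real" where
  "nesterov_weight \<beta> k = (real k - 1) / (real k + \<beta>)"

definition discrepancy_index ::
    "('a::real_inner \<Rightarrow> 'b::real_inner) \<Rightarrow> (nat \<Rightarrow> 'a) \<Rightarrow> 'b \<Rightarrow> real \<Rightarrow> nat" where
  "discrepancy_index A x y r = (LEAST k. norm (A (x k) - y) \<le> r)"

end

theory Submission
  imports
    Defs
    "HOL-Real_Asymp.Real_Asymp"
    "HOL-Computational_Algebra.Fundamental_Theorem_Algebra"
begin

text \<open>
  Write $T = A^*A$, $S = AA^*$.  The iterates are $x_k = g_k(T) A^* y$ for polynomials $g_k$, and
  with the residual polynomials $r_k(t) = 1 - t\,g_k(t)$ and $e = y^\delta - A x^\dagger$ one has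
  $A x_k - y^\delta = -A r_k(T) x^\dagger - r_k(S) e$ and
  $x_k - x^\dagger = -r_k(T) x^\dagger + A^* g_k(S) e$.  So everything reduces to scalar bounds on
  $r_k$ and $g_k$ over $[0,1]$, transported to the operators by the inequality
  $\|p(T)\| \le \sup_{\sigma(T)} |p|$.

  The scalar side: with $c = \sqrt{1-t}$ and $\nu = (\beta+1)/2$ the residuals are
  $r_{k+1}(t) = c^{k+2} q_k(c)$, where $q_k$ is the Gegenbauer polynomial $C_k^{(\nu)}$ divided by its
  value at $1$.  An energy that decreases along the three-term recurrence gives
  $|q_k| \le 1$, hence $|r_k| \le 1$ and $t\,g_k(t)^2 \le 4k^2$: the noise enters the discrepancy with
  factor at most $1$ and the error with factor at most $2k$.  The amplitude bound
  $|q_k(c)| \le C\,((k+1)\sqrt t)^{-\nu}$ (lemma \<open>gegenbauer_decay\<close>) together with the factor $c^k$ gives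
  $t^{\mu+1/2} |r_k(t)| \le C k^{-p}$ with
  $p = \min(2\mu+1,\ \mu+\frac12+\frac{\beta+1}4)$ (lemma \<open>nesterov_residual_decay\<close>).  The minimum is the
  origin of the two cases of the theorem.

  The rates follow.  Just before stopping,
  $\tau\delta < \|A r_k(T)x^\dagger\| + \delta \le C k^{-p} + \delta$, so
  $k(\delta) = O(\delta^{-1/p})$ and the noise part of the error is $O(\delta^{1-1/p})$.  At the stopping index
  $\|A r_k(T)x^\dagger\| \le (\tau+1)\delta$, and interpolating between this and the source condition bounds
  $\|r_k(T)x^\dagger\|$ by $O(\delta^{2\mu/(2\mu+1)})$, which is no worse than the noise part since
  $p \le 2\mu+1$.

  The operator \<^term>\<open>op_powr T \<mu>\<close> is a definite description, so its existence has to be established: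
  this needs the norm inequality above on the exact spectrum, which is obtained by
  factoring real polynomials into linear and positive quadratic factors.
\<close>

section \<open>Normalised Gegenbauer polynomials\<close>

text \<open>
  This is $C_n^{(\nu)}(c) / C_n^{(\nu)}(1)$.  The normalisation makes all values at $c = 1$ equal to $1$, and
  the recurrence then has the same weights $2(n+\nu)$, $n$, $n+2\nu$ as the Nesterov weights produce.
\<close>

fun gegenbauer :: "real \<Rightarrow> real \<Rightarrow> nat \<Rightarrow> real" where
  "gegenbauer \<nu> c 0 = 1"
| "gegenbauer \<nu> c (Suc 0) = c"
| "gegenbauer \<nu> c (Suc (Suc n)) =
     (2 * c * (real n + 1 + \<nu>) * gegenbauer \<nu> c (Suc n) - (real n + 1) * gegenbauer \<nu> c n)
       / (real n + 1 + 2 * \<nu>)"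

lemma gegenbauer_rec:
  assumes "\<nu> > 0"
  shows "(real n + 1 + 2 * \<nu>) * gegenbauer \<nu> c (Suc (Suc n)) =
    2 * c * (real n + 1 + \<nu>) * gegenbauer \<nu> c (Suc n) - (real n + 1) * gegenbauer \<nu> c n"
  using assms by (simp add: add_nonneg_eq_0_iff)

lemma gegenbauer_at_1: "\<nu> > 0 \<Longrightarrow> gegenbauer \<nu> 1 n = 1"
proof (induction \<nu> "1::real" n rule: gegenbauer.induct)
  case (3 \<nu> n)
  then have "real n + 1 + 2 * \<nu> \<noteq> 0" by (simp add: add_nonneg_eq_0_iff)
  with 3 show ?case by (simp add: field_simps)
qed auto

text \<open>
  The left-hand side is the invariant of the Chebyshev recurrence
  $q_{n+1} + q_{n-1} = 2c\,q_n$.  Here it changes by $-\frac{\nu}{n+\nu}(q_{n+1}-q_{n-1})^2 \le 0$ per step, starting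
  from $1 - c^2$ at $n = 0$.
\<close>

lemma gegenbauer_energy_decreasing:
  fixes \<nu> c :: real
  assumes "\<nu> > 0"
  defines "q \<equiv> gegenbauer \<nu> c"
  shows "(q (Suc n))\<^sup>2 - 2 * c * q (Suc n) * q n + (q n)\<^sup>2 \<le> 1 - c\<^sup>2"
proof (induction n)
  case 0
  show ?case by (simp add: q_def power2_eq_square)
next
  case (Suc n)
  define m where "m = real n + 1 + \<nu>"
  have m: "m > 0" using assms by (simp add: m_def)
  have "(real n + 1 + 2 * \<nu>) * q (Suc (Suc n)) =
    2 * c * (real n + 1 + \<nu>) * q (Suc n) - (real n + 1) * q n"
    unfolding q_def using gegenbauer_rec[OF assms(1)] .
  then have "m * (q (Suc (Suc n)) + q n - 2 * c * q (Suc n)) = - \<nu> * (q (Suc (Suc n)) - q n)"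
    by (simp add: m_def algebra_simps)
  then have "m * ((q (Suc (Suc n)) - q n) * (q (Suc (Suc n)) + q n - 2 * c * q (Suc n)))
      = - \<nu> * (q (Suc (Suc n)) - q n)\<^sup>2"
    by (simp add: power2_eq_square) algebra
  also have "\<dots> \<le> 0" using assms by simp
  finally have "(q (Suc (Suc n)) - q n) * (q (Suc (Suc n)) + q n - 2 * c * q (Suc n)) \<le> 0"
    using m by (simp add: mult_le_0_iff)
  moreover have "((q (Suc (Suc n)))\<^sup>2 - 2 * c * q (Suc (Suc n)) * q (Suc n) + (q (Suc n))\<^sup>2)
      - ((q (Suc n))\<^sup>2 - 2 * c * q (Suc n) * q n + (q n)\<^sup>2)
      = (q (Suc (Suc n)) - q n) * (q (Suc (Suc n)) + q n - 2 * c * q (Suc n))"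
    by (simp add: power2_eq_square algebra_simps)
  ultimately show ?case using Suc by linarith
qed

text \<open>
  Completing the square, the energy is at least $(1-c^2) q_n^2$, so its initial value $1-c^2$
  bounds $q_n^2$ by $1$.
\<close>

lemma abs_gegenbauer_le_1:
  assumes "\<nu> > 0" "0 \<le> c" "c \<le> 1"
  shows "\<bar>gegenbauer \<nu> c n\<bar> \<le> 1"
proof (cases "c = 1")
  case True
  then show ?thesis using assms by (simp add: gegenbauer_at_1)
next
  case False
  with assms have c: "1 - c\<^sup>2 > 0" by (simp add: abs_square_less_1)
  define q where "q = gegenbauer \<nu> c"
  have "(1 - c\<^sup>2) * (q n)\<^sup>2 + (q (Suc n) - c * q n)\<^sup>2
      = (q (Suc n))\<^sup>2 - 2 * c * q (Suc n) * q n + (q n)\<^sup>2"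
    by (simp add: power2_eq_square algebra_simps)
  also have "\<dots> \<le> 1 - c\<^sup>2"
    unfolding q_def by (rule gegenbauer_energy_decreasing[OF assms(1)])
  finally have "(1 - c\<^sup>2) * (q n)\<^sup>2 \<le> (1 - c\<^sup>2) * 1"
    using zero_le_power2[of "q (Suc n) - c * q n"] unfolding mult_1_right by linarith
  then have "(q n)\<^sup>2 \<le> 1" using c by (simp only: mult_le_cancel_left_pos)
  then show ?thesis by (simp add: q_def abs_square_le_1)
qed

text \<open>
  Rewritten for the increments, the recurrence reads
  $(n+2\nu)(q_{n+1}-q_n) = n(q_n-q_{n-1}) - 2(1-c)(n+\nu) q_n$: increments are damped and receive at most
  $2(1-c)$ per step.
\<close>

lemma abs_gegenbauer_diff_le:
  assumes "\<nu> > 0" "0 \<le> c" "c \<le> 1"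
  shows "\<bar>gegenbauer \<nu> c (Suc n) - gegenbauer \<nu> c n\<bar> \<le> 2 * (1 - c) * (real n + 1)"
proof (induction n)
  case 0
  show ?case using assms by simp
next
  case (Suc n)
  define q where "q = gegenbauer \<nu> c"
  define a where "a = real n + 1 + 2 * \<nu>"
  have a: "a > 0" "real n + 1 \<le> a" "real n + 1 + \<nu> \<le> a" using assms by (simp_all add: a_def)
  have q1: "\<bar>q (Suc n)\<bar> \<le> 1" unfolding q_def by (rule abs_gegenbauer_le_1[OF assms])
  have "a * q (Suc (Suc n)) = 2 * c * (real n + 1 + \<nu>) * q (Suc n) - (real n + 1) * q n"
    unfolding q_def a_def using gegenbauer_rec[OF assms(1)] .
  then have eq: "a * (q (Suc (Suc n)) - q (Suc n)) =
      (real n + 1) * (q (Suc n) - q n) - 2 * (1 - c) * (real n + 1 + \<nu>) * q (Suc n)"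
    by (simp add: a_def algebra_simps)
  have "a * \<bar>q (Suc (Suc n)) - q (Suc n)\<bar> = \<bar>a * (q (Suc (Suc n)) - q (Suc n))\<bar>"
    using a by (simp add: abs_mult)
  also have "\<dots> \<le> \<bar>(real n + 1) * (q (Suc n) - q n)\<bar> + \<bar>2 * (1 - c) * (real n + 1 + \<nu>) * q (Suc n)\<bar>"
    unfolding eq by (rule abs_triangle_ineq4)
  also have "\<dots> = (real n + 1) * \<bar>q (Suc n) - q n\<bar> + 2 * (1 - c) * ((real n + 1 + \<nu>) * \<bar>q (Suc n)\<bar>)"
    using assms by (simp add: abs_mult)
  also have "\<dots> \<le> a * (2 * (1 - c) * (real n + 1)) + 2 * (1 - c) * (a * 1)"
    using Suc a q1 assms unfolding q_def[symmetric]
    by (intro add_mono mult_mono mult_left_mono) auto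
  also have "\<dots> = a * (2 * (1 - c) * (real (Suc n) + 1))" by (simp add: algebra_simps)
  finally show ?case using a by (simp add: q_def)
qed

lemma one_minus_gegenbauer_le:
  assumes "\<nu> > 0" "0 \<le> c" "c \<le> 1"
  shows "\<bar>1 - gegenbauer \<nu> c n\<bar> \<le> 2 * (1 - c) * (real n)\<^sup>2"
proof (induction n)
  case (Suc n)
  have "\<bar>1 - gegenbauer \<nu> c (Suc n)\<bar> \<le> 2 * (1 - c) * (real n)\<^sup>2 + 2 * (1 - c) * (real n + 1)"
    using Suc abs_gegenbauer_diff_le[OF assms, of n] by linarith
  also have "\<dots> \<le> 2 * (1 - c) * (real (Suc n))\<^sup>2"
    using mult_left_mono[of "(real n)\<^sup>2 + (real n + 1)" "(real (Suc n))\<^sup>2" "2 * (1 - c)"] assms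
    by (simp add: power2_eq_square algebra_simps)
  finally show ?case .
qed simp

text \<open>
  Finitely many exceptional indices are absorbed into the constant, since $g$ has no zeros.
\<close>

lemma bounded_of_bigo_nat:
  fixes f g :: "nat \<Rightarrow> real"
  assumes "f \<in> O(g)" and "\<And>n. n \<ge> 1 \<Longrightarrow> g n > 0"
  obtains K where "K > 0" "\<And>n. n \<ge> 1 \<Longrightarrow> \<bar>f n\<bar> \<le> K * g n"
proof -
  from landau_o.bigE[OF assms(1)] obtain c
    where c: "c > 0" "eventually (\<lambda>n. norm (f n) \<le> c * norm (g n)) at_top" by metis
  then obtain N where N: "\<And>n. n \<ge> N \<Longrightarrow> \<bar>f n\<bar> \<le> c * \<bar>g n\<bar>"
    by (auto simp: eventually_at_top_linorder)
  define K where "K = c + (\<Sum>n<N. \<bar>f n\<bar> / \<bar>g n\<bar>)"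
  have K: "K \<ge> c" by (simp add: K_def sum_nonneg)
  have "\<bar>f n\<bar> \<le> K * g n" if n: "n \<ge> 1" for n
  proof (cases "n < N")
    case True
    then have "\<bar>f n\<bar> / \<bar>g n\<bar> \<le> (\<Sum>n<N. \<bar>f n\<bar> / \<bar>g n\<bar>)"
      by (intro member_le_sum) auto
    also have "\<dots> \<le> K" using c by (simp add: K_def)
    finally show ?thesis using assms(2)[OF n] by (simp add: field_simps)
  next
    case False
    then have "\<bar>f n\<bar> \<le> c * \<bar>g n\<bar>" using N by simp
    also have "\<dots> \<le> K * g n" using assms(2)[OF n] K by simp
    finally show ?thesis .
  qed
  with K c show ?thesis by (intro that[of K]) auto
qed

text \<open>
  The first two numbers compared with $1$ are the coefficients of the recurrence for the rescaled sequence
  $u_n = (n+1)^\nu q_n$, namely $u_{n+1} = 2c\,k_n u_n - h_n u_{n-1}$.  The exponent $\nu$ is exactly the one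
  for which the terms of order $1/n$ cancel, so that the perturbation of the Chebyshev recurrence is summable.
  The third bound controls the growth of the scaling factors.
\<close>

lemma rescaled_recurrence_coefficients:
  fixes \<nu> :: real
  assumes "\<nu> > 0"
  obtains K where "K > 0"
    and "\<And>n. n \<ge> 1 \<Longrightarrow>
      \<bar>(real n + \<nu>) / (real n + 2 * \<nu>) * ((real n + 2) / (real n + 1)) powr \<nu> - 1\<bar> \<le> K / (real n)\<^sup>2"
    and "\<And>n. n \<ge> 1 \<Longrightarrow>
      \<bar>real n / (real n + 2 * \<nu>) * ((real n + 2) / real n) powr \<nu> - 1\<bar> \<le> K / (real n)\<^sup>2"
    and "\<And>n. n \<ge> 1 \<Longrightarrow> ((real n + 2) / (real n + 1)) powr \<nu> - 1 \<le> K / real n"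
proof -
  have 1: "(\<lambda>n. (real n + \<nu>) / (real n + 2 * \<nu>) * ((real n + 2) / (real n + 1)) powr \<nu> - 1)
      \<in> O(\<lambda>n. 1 / (real n)\<^sup>2)"
    using assms by real_asymp
  have 2: "(\<lambda>n. real n / (real n + 2 * \<nu>) * ((real n + 2) / real n) powr \<nu> - 1)
      \<in> O(\<lambda>n. 1 / (real n)\<^sup>2)"
    using assms by real_asymp
  have 3: "(\<lambda>n. ((real n + 2) / (real n + 1)) powr \<nu> - 1) \<in> O(\<lambda>n. 1 / real n)"
    using assms by real_asymp
  obtain K1 K2 K3 where K: "K1 > 0" "K2 > 0" "K3 > 0" and
    B: "\<And>n. n \<ge> 1 \<Longrightarrow>
      \<bar>(real n + \<nu>) / (real n + 2 * \<nu>) * ((real n + 2) / (real n + 1)) powr \<nu> - 1\<bar> \<le> K1 * (1 / (real n)\<^sup>2)"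
    "\<And>n. n \<ge> 1 \<Longrightarrow>
      \<bar>real n / (real n + 2 * \<nu>) * ((real n + 2) / real n) powr \<nu> - 1\<bar> \<le> K2 * (1 / (real n)\<^sup>2)"
    "\<And>n. n \<ge> 1 \<Longrightarrow> \<bar>((real n + 2) / (real n + 1)) powr \<nu> - 1\<bar> \<le> K3 * (1 / real n)"
    by (rule bounded_of_bigo_nat[OF 1], simp, rule bounded_of_bigo_nat[OF 2], simp,
        rule bounded_of_bigo_nat[OF 3], simp, blast)
  have le: "a \<le> (K1 + K2 + K3) / b" if "a \<le> L * (1 / b)" "L \<le> K1 + K2 + K3" "b > 0" for a b L :: real
  proof -
    have "L * (1 / b) \<le> (K1 + K2 + K3) * (1 / b)"
      by (rule mult_right_mono) (use that in auto)
    with that show ?thesis by simp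
  qed
  show ?thesis
  proof (rule that[of "K1 + K2 + K3"], goal_cases)
    case (2 n) then show ?case using K by (intro le[OF B(1)]) auto
  next
    case (3 n) then show ?case using K by (intro le[OF B(2)]) auto
  next
    case (4 n) then show ?case using K abs_ge_self order_trans by (intro le[OF order_trans[OF abs_ge_self B(3)]]) auto
  qed (use K in simp)
qed

text \<open>
  For $c = \cos\theta$, $s = \sin\theta$ this is $|b - e^{i\theta} a|$, the amplitude of an oscillation with
  consecutive values $a, b$; the Chebyshev recurrence leaves it unchanged.
\<close>

definition rotation_defect :: "real \<Rightarrow> real \<Rightarrow> real \<Rightarrow> real \<Rightarrow> real" where
  "rotation_defect c s a b = cmod (of_real b - Complex c s * of_real a)"

text \<open>
  Take imaginary parts of $b - e^{i\theta}a$, respectively of $e^{-i\theta}b - a$.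
\<close>

lemma rotation_defect_ge:
  assumes "c\<^sup>2 + s\<^sup>2 = 1" "s > 0"
  shows "\<bar>a\<bar> * s \<le> rotation_defect c s a b" "\<bar>b\<bar> * s \<le> rotation_defect c s a b"
proof -
  have "\<bar>a\<bar> * s = \<bar>Im (of_real b - Complex c s * of_real a)\<bar>"
    using assms by (simp add: abs_mult)
  also have "\<dots> \<le> rotation_defect c s a b" unfolding rotation_defect_def by (rule abs_Im_le_cmod)
  finally show "\<bar>a\<bar> * s \<le> rotation_defect c s a b" .
  have cmod_z: "cmod (Complex c (- s)) = 1" using assms by (simp add: cmod_def)
  have "\<bar>b\<bar> * s = \<bar>Im (Complex c (- s) * of_real b - of_real a)\<bar>"
    using assms by (simp add: abs_mult)
  also have "\<dots> \<le> cmod (Complex c (- s) * of_real b - of_real a)" by (rule abs_Im_le_cmod)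
  also have "Complex c (- s) * of_real b - of_real a
      = Complex c (- s) * (of_real b - Complex c s * of_real a)"
    using assms(1) by (simp add: complex_eq_iff power2_eq_square right_diff_distrib
        flip: mult.assoc distrib_right)
  also have "cmod \<dots> = rotation_defect c s a b"
    by (simp only: norm_mult cmod_z rotation_defect_def mult_1_left)
  finally show "\<bar>b\<bar> * s \<le> rotation_defect c s a b" .
qed

text \<open>
  One step of the recurrence with perturbed coefficients: the unperturbed part is a multiplication
  by $e^{-i\theta}$, and the perturbation is controlled because each value is at most amplitude$/s$.
\<close>

lemma rotation_defect_step:
  assumes cs: "c\<^sup>2 + s\<^sup>2 = 1" "s > 0" "0 \<le> c" "c \<le> 1"
    and k: "\<bar>k - 1\<bar> \<le> e" and h: "\<bar>h - 1\<bar> \<le> e"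
    and rec: "d = 2 * c * k * b - h * a"
  shows "rotation_defect c s b d \<le> rotation_defect c s a b * (1 + 3 * e / s)"
proof -
  define V where "V = rotation_defect c s a b"
  have V0: "V \<ge> 0" by (simp add: V_def rotation_defect_def)
  have e: "e \<ge> 0" using k by linarith
  have u: "\<bar>a\<bar> \<le> V / s" "\<bar>b\<bar> \<le> V / s"
    using rotation_defect_ge[OF cs(1,2), of a b] rotation_defect_ge[OF cs(1,2), of b a] cs(2)
    by (simp_all add: V_def field_simps)
  have cmod_z: "cmod (Complex c (- s)) = 1" using cs by (simp add: cmod_def)
  define t where "t = 2 * c * (k - 1) * b - (h - 1) * a"
  have "of_real d - Complex c s * of_real b
      = of_real t + Complex c (- s) * (of_real b - Complex c s * of_real a)"
  proof -
    have "c * (c * a) + s * (s * a) = a"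
      using cs(1) by (simp add: power2_eq_square flip: mult.assoc distrib_right)
    then show ?thesis by (simp add: complex_eq_iff rec t_def algebra_simps)
  qed
  then have "rotation_defect c s b d \<le> \<bar>t\<bar> + V"
    unfolding rotation_defect_def V_def
    by (metis norm_triangle_ineq cmod_z norm_mult norm_of_real mult_1_left)
  also have "\<bar>t\<bar> \<le> 2 * c * \<bar>k - 1\<bar> * \<bar>b\<bar> + \<bar>h - 1\<bar> * \<bar>a\<bar>"
    unfolding t_def using abs_triangle_ineq4[of "2 * c * (k - 1) * b" "(h - 1) * a"] cs
    by (simp add: abs_mult)
  also have "\<dots> \<le> 2 * 1 * e * (V / s) + e * (V / s)"
    using cs k h e V0 u by (intro add_mono mult_mono) auto
  finally show ?thesis by (simp add: V_def[symmetric] algebra_simps)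
qed

text \<open>
  The amplitude $V_n$ of $u_n = (n+1)^\nu q_n$ satisfies $V_{n+1} \le V_n (1 + O(1/(s n^2)))$.  The product of these
  factors is bounded from $N \approx 1/s$ onwards, as $\sum_{n\ge N} 1/(s n^2) \approx 1/(sN)$.  At $n = N$ the bounds on
  $q_n$ and on its increments give $V_N = O(s\cdot s^{-\nu})$, hence $|u_n| \le V_n/s = O(s^{-\nu})$.  Before $N$ the bound
  is trivial because $(n+1)s \le 2$ there.
\<close>

lemma gegenbauer_decay:
  fixes \<nu> :: real
  assumes \<nu>: "\<nu> > 0"
  obtains C where "C > 0"
    and "\<And>c s n. 0 \<le> c \<Longrightarrow> 0 < s \<Longrightarrow> c\<^sup>2 + s\<^sup>2 = 1 \<Longrightarrow>
      \<bar>gegenbauer \<nu> c n\<bar> \<le> C * ((real n + 1) * s) powr (- \<nu>)"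
proof -
  obtain K where K: "K > 0"
    and K1: "\<And>n. n \<ge> 1 \<Longrightarrow>
      \<bar>(real n + \<nu>) / (real n + 2 * \<nu>) * ((real n + 2) / (real n + 1)) powr \<nu> - 1\<bar> \<le> K / (real n)\<^sup>2"
    and K2: "\<And>n. n \<ge> 1 \<Longrightarrow>
      \<bar>real n / (real n + 2 * \<nu>) * ((real n + 2) / real n) powr \<nu> - 1\<bar> \<le> K / (real n)\<^sup>2"
    and K3: "\<And>n. n \<ge> 1 \<Longrightarrow> ((real n + 2) / (real n + 1)) powr \<nu> - 1 \<le> K / real n"
    using rescaled_recurrence_coefficients[OF \<nu>] by blast
  define C where "C = 2 powr \<nu> + (6 * 2 powr \<nu> + K + 2) * 3 powr \<nu> * exp (3 * K)"
  have pos: "(6 * 2 powr \<nu> + K + 2) * 3 powr \<nu> * exp (3 * K) > 0"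
    using K by (intro mult_pos_pos) (auto intro!: add_pos_pos)
  have C: "C > 0" unfolding C_def using pos by (intro add_pos_pos) auto
  have "\<bar>gegenbauer \<nu> c n\<bar> \<le> C * ((real n + 1) * s) powr (- \<nu>)"
    if c: "0 \<le> c" and s: "0 < s" and cs: "c\<^sup>2 + s\<^sup>2 = 1" for c s :: real and n :: nat
  proof -
    have "c\<^sup>2 \<le> 1" "s\<^sup>2 \<le> 1" using cs zero_le_power2[of s] zero_le_power2[of c] by linarith+
    then have c1: "c \<le> 1" and s1: "s \<le> 1" using c s by (simp_all add: abs_square_le_1)
    have "(1 - c) * 1 \<le> (1 - c) * (1 + c)" using c c1 by (intro mult_left_mono) auto
    also have "\<dots> = s\<^sup>2" using cs by (simp add: power2_eq_square algebra_simps)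
    finally have c_s: "1 - c \<le> s\<^sup>2" by simp
    have s_sq: "s\<^sup>2 \<le> s" using s s1 by (simp add: power2_eq_square)
    define q where "q = gegenbauer \<nu> c"
    have q1: "\<bar>q m\<bar> \<le> 1" for m unfolding q_def by (rule abs_gegenbauer_le_1[OF \<nu> c c1])
    define w where "w m = (real m + 1) powr \<nu>" for m :: nat
    have w: "w m > 0" for m by (simp add: w_def)
    define u where "u m = w m * q m" for m
    define V where "V m = rotation_defect c s (u m) (u (Suc m))" for m
    have V0: "V m \<ge> 0" for m by (simp add: V_def rotation_defect_def)
    have V_step: "V (Suc m) \<le> V m * (1 + 3 * K / (s * (real (Suc m))\<^sup>2))" for m
    proof -
      define k where "k = (real (Suc m) + \<nu>) / (real (Suc m) + 2 * \<nu>)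
        * ((real (Suc m) + 2) / (real (Suc m) + 1)) powr \<nu>"
      define h where "h = real (Suc m) / (real (Suc m) + 2 * \<nu>)
        * ((real (Suc m) + 2) / real (Suc m)) powr \<nu>"
      define e where "e = K / (real (Suc m))\<^sup>2"
      have k: "\<bar>k - 1\<bar> \<le> e" unfolding k_def e_def by (rule K1) simp
      have h: "\<bar>h - 1\<bar> \<le> e" unfolding h_def e_def by (rule K2) simp
      define p where "p = real m + 1 + 2 * \<nu>"
      have p: "p \<noteq> 0" using \<nu> by (simp add: p_def add_nonneg_eq_0_iff)
      have k': "k * w (Suc m) = (real m + 1 + \<nu>) / p * w (Suc (Suc m))"
        by (simp add: k_def w_def p_def powr_divide add_ac)
      have h': "h * w m = (real m + 1) / p * w (Suc (Suc m))"
        by (simp add: h_def w_def p_def powr_divide add_ac)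
      have "u (Suc (Suc m)) =
          2 * c * ((real m + 1 + \<nu>) / p * w (Suc (Suc m))) * q (Suc m)
          - ((real m + 1) / p * w (Suc (Suc m))) * q m"
      proof -
        have eq: "q (Suc (Suc m)) = (2 * c * (real m + 1 + \<nu>) * q (Suc m) - (real m + 1) * q m) / p"
          by (simp add: q_def p_def)
        show ?thesis unfolding u_def eq by (simp add: diff_divide_distrib algebra_simps)
      qed
      also have "\<dots> = 2 * c * k * u (Suc m) - h * u m"
        unfolding k'[symmetric] h'[symmetric] u_def by simp
      finally have "V (Suc m) \<le> V m * (1 + 3 * e / s)"
        unfolding V_def by (rule rotation_defect_step[OF cs s c c1 k h])
      then show ?thesis by (simp add: e_def mult.commute)
    qed
    define D where "D = 3 * K"
    \<comment> \<open>The exponential absorbs the growth factors: 1 / (m + 1)^2 is at most 1 / m - 1 / (m + 1),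
      so W is nonincreasing.\<close>
    define W where "W m = V m * exp (D / (s * real m))" for m
    have W_step: "W (Suc m) \<le> W m" if m: "m \<ge> 1" for m
    proof -
      define x where "x = D / (s * real m) - D / (s * real (Suc m))"
      have "x = D / s * (1 / real m - 1 / real (Suc m))"
        by (simp add: x_def right_diff_distrib)
      also have "1 / real m - 1 / real (Suc m) = 1 / (real m * real (Suc m))"
        using m by (simp add: divide_simps)
      finally have "x = D / (s * (real m * real (Suc m)))" by simp
      moreover have "D / (s * (real (Suc m))\<^sup>2) \<le> D / (s * (real m * real (Suc m)))"
        using m s K by (intro divide_left_mono mult_left_mono mult_pos_pos)
          (auto simp: D_def power2_eq_square)
      ultimately have "1 + 3 * K / (s * (real (Suc m))\<^sup>2) \<le> 1 + x" by (simp add: D_def)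
      also have "\<dots> \<le> exp x" by (rule exp_ge_add_one_self)
      finally have "V (Suc m) \<le> V m * exp x"
        using V_step[of m] V0[of m] by (meson mult_left_mono order_trans)
      then have "W (Suc m) \<le> V m * exp x * exp (D / (s * real (Suc m)))"
        unfolding W_def by (intro mult_right_mono) auto
      also have "\<dots> = W m" by (simp add: W_def x_def exp_diff)
      finally show ?thesis .
    qed
    define N where "N = nat \<lceil>1 / s\<rceil>"
    have N: "1 / s \<le> real N" "real N \<le> 1 / s + 1"
      using s ceiling_correct[of "1 / s"] unfolding N_def
      by (simp_all add: real_nat_ceiling_ge of_nat_nat)
    have "1 / s \<ge> 1" using s s1 by simp
    then have N1: "N \<ge> 1" "N \<noteq> 0" using N(1) by linarith+
    have sN: "1 \<le> s * real N" "s * real N \<le> 2" "s * (real N + 1) \<le> 3"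
      using N s s1 by (simp_all add: field_simps)
    show ?thesis
    proof (cases "n < N")
      case True
      have "((real n + 1) * s) powr \<nu> \<le> 2 powr \<nu>"
      proof (rule powr_mono2)
        have "(real n + 1) * s \<le> real N * s" using True s by (intro mult_right_mono) auto
        then show "(real n + 1) * s \<le> 2" using sN by (simp add: mult.commute)
      qed (use s \<nu> in auto)
      also have "\<dots> \<le> C" using pos by (simp add: C_def)
      finally have T: "((real n + 1) * s) powr \<nu> \<le> C" .
      have "((real n + 1) * s) powr \<nu> > 0" using s by simp
      with T have "1 \<le> C * ((real n + 1) * s) powr (- \<nu>)"
        unfolding powr_minus by (metis divide_inverse le_divide_eq_1_pos)
      with q1[of n] show ?thesis by (simp add: q_def)
    next
      case False
      have wN: "w (Suc N) \<le> 2 powr \<nu> * w N"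
      proof -
        have "w (Suc N) \<le> (2 * (real N + 1)) powr \<nu>"
          unfolding w_def using \<nu> by (intro powr_mono2) auto
        also have "\<dots> = 2 powr \<nu> * w N" unfolding w_def by (rule powr_mult)
        finally show ?thesis .
      qed
      have wN': "w (Suc N) - w N \<le> w N * (K * s)"
      proof -
        have "w (Suc N) = w N * ((real N + 2) / (real N + 1)) powr \<nu>"
          by (simp add: w_def powr_divide add_ac)
        then have "w (Suc N) - w N = w N * (((real N + 2) / (real N + 1)) powr \<nu> - 1)"
          by (simp add: right_diff_distrib)
        also have "\<dots> \<le> w N * (K / real N)"
          using K3[OF N1(1)] w[of N] by (intro mult_left_mono) auto
        also have "K / real N \<le> K * s" using sN N1 K by (simp add: field_simps)
        then have "w N * (K / real N) \<le> w N * (K * s)" using w[of N] by (intro mult_left_mono) auto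
        finally show ?thesis .
      qed
      have qd: "\<bar>q (Suc N) - q N\<bar> \<le> 6 * s"
      proof -
        have "\<bar>q (Suc N) - q N\<bar> \<le> 2 * (1 - c) * (real N + 1)"
          unfolding q_def by (rule abs_gegenbauer_diff_le[OF \<nu> c c1])
        also have "\<dots> \<le> 2 * s\<^sup>2 * (real N + 1)" using c_s c1 by (intro mult_mono) auto
        also have "\<dots> = 2 * s * (s * (real N + 1))" by (simp add: power2_eq_square)
        also have "\<dots> \<le> 2 * s * 3" using sN s by (intro mult_left_mono) auto
        finally show ?thesis by simp
      qed
      define z where "z = Complex c s"
      have "of_real (u (Suc N)) - z * of_real (u N) =
          of_real (w (Suc N) * (q (Suc N) - q N) + (w (Suc N) - w N) * q N) + (1 - z) * of_real (u N)"
        by (simp add: u_def algebra_simps)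
      then have "V N \<le> \<bar>w (Suc N) * (q (Suc N) - q N) + (w (Suc N) - w N) * q N\<bar> + cmod (1 - z) * \<bar>u N\<bar>"
        unfolding V_def rotation_defect_def z_def[symmetric]
        by (metis norm_triangle_ineq norm_mult norm_of_real)
      also have "\<bar>w (Suc N) * (q (Suc N) - q N) + (w (Suc N) - w N) * q N\<bar>
          \<le> w (Suc N) * \<bar>q (Suc N) - q N\<bar> + \<bar>w (Suc N) - w N\<bar> * \<bar>q N\<bar>"
        using abs_triangle_ineq[of "w (Suc N) * (q (Suc N) - q N)" "(w (Suc N) - w N) * q N"] w[of "Suc N"]
        by (simp add: abs_mult)
      also have "\<bar>w (Suc N) - w N\<bar> = w (Suc N) - w N"
        unfolding w_def using \<nu> by (simp add: powr_mono2)
      also have "w (Suc N) * \<bar>q (Suc N) - q N\<bar> + (w (Suc N) - w N) * \<bar>q N\<bar>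
          \<le> (2 powr \<nu> * w N) * (6 * s) + w N * (K * s) * 1"
        using wN wN' qd q1[of N] w[of N] w[of "Suc N"] s K
        by (intro add_mono mult_mono) auto
      also have "cmod (1 - z) * \<bar>u N\<bar> \<le> (2 * s) * w N"
      proof (rule mult_mono)
        have "cmod (1 - z) \<le> \<bar>Re (1 - z)\<bar> + \<bar>Im (1 - z)\<bar>" by (rule cmod_le)
        also have "\<dots> \<le> 2 * s" using c1 s c_s s_sq by (simp add: z_def)
        finally show "cmod (1 - z) \<le> 2 * s" .
        show "\<bar>u N\<bar> \<le> w N" using q1[of N] w[of N] by (simp add: u_def abs_mult)
      qed (use s in auto)
      finally have VN: "V N \<le> (6 * 2 powr \<nu> + K + 2) * s * w N" by (simp add: algebra_simps)
      have w_le: "w N \<le> 3 powr \<nu> * s powr (- \<nu>)"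
      proof -
        have "w N \<le> (3 / s) powr \<nu>"
          unfolding w_def using sN s \<nu> by (intro powr_mono2) (auto simp: field_simps)
        also have "\<dots> = 3 powr \<nu> * s powr (- \<nu>)"
          by (simp add: powr_divide powr_minus_divide)
        finally show ?thesis .
      qed
      have WnN: "W n \<le> W N" using False
      proof (induction n)
        case (Suc n)
        show ?case
        proof (cases "Suc n = N")
          case False
          then have "W n \<le> W N" "n \<ge> 1" using Suc N1 by auto
          then show ?thesis using W_step[of n] by simp
        qed simp
      qed (use N1 in simp)
      have "\<bar>u n\<bar> * s \<le> V n" unfolding V_def by (rule rotation_defect_ge[OF cs s])
      also have "\<dots> \<le> W n"
      proof -
        have "V n * 1 \<le> V n * exp (D / (s * real n))"
          using V0[of n] K s by (intro mult_left_mono) (simp_all add: D_def)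
        then show ?thesis by (simp add: W_def)
      qed
      also note WnN
      also have "W N \<le> V N * exp D"
      proof -
        have "D / (s * real N) \<le> D / 1" using sN K by (intro divide_left_mono) (auto simp: D_def)
        then show ?thesis unfolding W_def using V0[of N] by (intro mult_left_mono) auto
      qed
      also have "\<dots> \<le> (6 * 2 powr \<nu> + K + 2) * s * (3 powr \<nu> * s powr (- \<nu>)) * exp D"
        using w_le s K
        by (intro mult_right_mono order_trans[OF VN] mult_left_mono) auto
      also have "\<dots> = ((6 * 2 powr \<nu> + K + 2) * 3 powr \<nu> * exp D) * s powr (- \<nu>) * s"
        by (simp add: algebra_simps)
      also have "\<dots> \<le> C * s powr (- \<nu>) * s"
        using s by (intro mult_right_mono) (auto simp: C_def D_def)
      finally have "\<bar>u n\<bar> \<le> C * s powr (- \<nu>)" using s by simp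
      then have "(real n + 1) powr \<nu> * \<bar>q n\<bar> \<le> C * s powr (- \<nu>)"
        by (simp add: u_def w_def abs_mult)
      then have "\<bar>q n\<bar> \<le> C * s powr (- \<nu>) / (real n + 1) powr \<nu>"
        by (simp add: pos_le_divide_eq mult.commute)
      then show ?thesis using s
        by (simp add: q_def powr_mult powr_minus_divide mult.commute)
    qed
  qed
  with C show ?thesis by (rule that)
qed

section \<open>Residual polynomials of the Nesterov iteration\<close>

text \<open>
  These are the polynomials $g_k$ with $x_k = g_k(A^*A) A^* y$.
\<close>

fun nesterov_filter :: "(nat \<Rightarrow> real) \<Rightarrow> nat \<Rightarrow> real poly" where
  "nesterov_filter \<alpha> 0 = 0"
| "nesterov_filter \<alpha> (Suc 0) = 1"
| "nesterov_filter \<alpha> (Suc (Suc k)) =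
     (let z = nesterov_filter \<alpha> (Suc k)
            + smult (\<alpha> (Suc k)) (nesterov_filter \<alpha> (Suc k) - nesterov_filter \<alpha> k)
      in z + (1 - pCons 0 z))"

definition nesterov_residual :: "(nat \<Rightarrow> real) \<Rightarrow> nat \<Rightarrow> real poly" where
  "nesterov_residual \<alpha> k = 1 - pCons 0 (nesterov_filter \<alpha> k)"

lemma poly_nesterov_residual:
  "poly (nesterov_residual \<alpha> k) t = 1 - t * poly (nesterov_filter \<alpha> k) t"
  by (simp add: nesterov_residual_def)

lemma poly_nesterov_residual_rec:
  "poly (nesterov_residual \<alpha> (Suc (Suc k))) t = (1 - t) *
     (poly (nesterov_residual \<alpha> (Suc k)) t
      + \<alpha> (Suc k) * (poly (nesterov_residual \<alpha> (Suc k)) t - poly (nesterov_residual \<alpha> k) t))"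
  by (simp add: poly_nesterov_residual Let_def algebra_simps)

text \<open>
  Dividing the recurrence for $r_k$ by powers of $c = \sqrt{1-t}$ turns the factor $1-t$ into a factor $c$ of
  the first term only, which is the Gegenbauer recurrence.  The index shift comes from
  $\alpha_1 = 0$: the value $r_0$ does not influence $r_2$.
\<close>

lemma nesterov_residual_eq_gegenbauer:
  assumes "\<beta> > -1" "t \<le> 1"
  shows "poly (nesterov_residual (nesterov_weight \<beta>) (Suc k)) t =
    sqrt (1 - t) ^ (k + 2) * gegenbauer ((\<beta> + 1) / 2) (sqrt (1 - t)) k"
proof -
  define \<nu> c where "\<nu> = (\<beta> + 1) / 2" and "c = sqrt (1 - t)"
  have \<nu>: "\<nu> > 0" using assms by (simp add: \<nu>_def)
  have c: "1 - t = c\<^sup>2" using assms by (simp add: c_def)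
  define r where "r k = poly (nesterov_residual (nesterov_weight \<beta>) k) t" for k
  have r1: "r (Suc 0) = c\<^sup>2" by (simp add: r_def poly_nesterov_residual flip: c)
  have rec: "r (Suc (Suc k)) =
      c\<^sup>2 * (r (Suc k) + nesterov_weight \<beta> (Suc k) * (r (Suc k) - r k))" for k
    unfolding r_def c[symmetric] by (rule poly_nesterov_residual_rec)
  \<comment> \<open>Two consecutive indices at once, as the recurrence has order two.\<close>
  have "r (Suc k) = c ^ (k + 2) * gegenbauer \<nu> c k \<and>
        r (Suc (Suc k)) = c ^ (k + 3) * gegenbauer \<nu> c (Suc k)"
  proof (induction k)
    case 0
    show ?case using rec[of 0] r1 by (simp add: nesterov_weight_def eval_nat_numeral)
  next
    case (Suc k)
    define p where "p = real k + 1 + 2 * \<nu>"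
    have p: "p > 0" using \<nu> by (simp add: p_def)
    have weight: "nesterov_weight \<beta> (Suc (Suc k)) = (real k + 1) / p"
      by (simp add: nesterov_weight_def p_def \<nu>_def add_ac)
    have weight': "1 + (real k + 1) / p = 2 * (real k + 1 + \<nu>) / p"
      using p by (simp add: divide_simps) (simp add: p_def)
    have "r (Suc (Suc (Suc k))) = c\<^sup>2 * ((1 + (real k + 1) / p) * r (Suc (Suc k)) - (real k + 1) / p * r (Suc k))"
      unfolding rec weight by (simp add: algebra_simps)
    also have "\<dots> = c ^ (k + 4) *
        ((2 * (real k + 1 + \<nu>) / p) * c * gegenbauer \<nu> c (Suc k) - (real k + 1) / p * gegenbauer \<nu> c k)"
      using Suc unfolding weight' by (simp add: eval_nat_numeral right_diff_distrib mult_ac)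
    also have "(2 * (real k + 1 + \<nu>) / p) * c * gegenbauer \<nu> c (Suc k) - (real k + 1) / p * gegenbauer \<nu> c k
        = gegenbauer \<nu> c (Suc (Suc k))"
      unfolding gegenbauer.simps p_def[symmetric] by (simp add: diff_divide_distrib mult_ac)
    finally show ?case using Suc by (simp add: eval_nat_numeral)
  qed
  then show ?thesis by (simp add: r_def \<nu>_def c_def)
qed

lemma abs_nesterov_residual_le_1:
  assumes "\<beta> > -1" "0 \<le> t" "t \<le> 1"
  shows "\<bar>poly (nesterov_residual (nesterov_weight \<beta>) k) t\<bar> \<le> 1"
proof (cases k)
  case 0
  then show ?thesis by (simp add: nesterov_residual_def)
next
  case (Suc m)
  have "\<bar>gegenbauer ((\<beta> + 1) / 2) (sqrt (1 - t)) m\<bar> \<le> 1"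
    using assms by (intro abs_gegenbauer_le_1) auto
  moreover have "sqrt (1 - t) ^ (m + 2) \<le> 1" using assms by (intro power_le_one) auto
  ultimately show ?thesis using assms unfolding Suc nesterov_residual_eq_gegenbauer[OF assms(1,3)]
    by (simp add: abs_mult mult_le_one)
qed

text \<open>
  The deviation of $c^{k+1}$ from $1$ is at most $(k+1)(1-c)$ by Bernoulli, that of the Gegenbauer factor is
  quadratic in $k$ times $1-c$, and $1-c \le 1-c^2 = t$.
\<close>

lemma one_minus_nesterov_residual_le:
  assumes "\<beta> > -1" "0 \<le> t" "t \<le> 1"
  shows "\<bar>1 - poly (nesterov_residual (nesterov_weight \<beta>) k) t\<bar> \<le> 2 * (real k)\<^sup>2 * t"
proof (cases k)
  case 0
  then show ?thesis by (simp add: nesterov_residual_def)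
next
  case (Suc m)
  define c where "c = sqrt (1 - t)"
  define q where "q = gegenbauer ((\<beta> + 1) / 2) c m"
  have c: "0 \<le> c" "c \<le> 1" using assms by (auto simp: c_def)
  have "(1 - c) * 1 \<le> (1 - c) * (1 + c)" using c by (intro mult_left_mono) auto
  also have "\<dots> = t" using assms by (simp add: c_def algebra_simps flip: power2_eq_square)
  finally have ct: "1 - c \<le> t" by simp
  have "1 + real (m + 2) * (c - 1) \<le> (1 + (c - 1)) ^ (m + 2)"
    using c by (intro Bernoulli_inequality) auto
  then have "1 - c ^ (m + 2) \<le> real (m + 2) * (1 - c)" by (simp add: algebra_simps)
  also have "\<dots> \<le> real (m + 2) * t" using ct by (intro mult_left_mono) auto
  finally have a: "1 - c ^ (m + 2) \<le> real (m + 2) * t" .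
  have "\<bar>1 - q\<bar> \<le> 2 * (1 - c) * (real m)\<^sup>2"
    unfolding q_def using assms c by (intro one_minus_gegenbauer_le) auto
  also have "\<dots> \<le> 2 * t * (real m)\<^sup>2" using ct by (intro mult_right_mono) auto
  finally have b: "\<bar>1 - q\<bar> \<le> 2 * t * (real m)\<^sup>2" .
  have c_pow: "0 \<le> c ^ (m + 2)" "c ^ (m + 2) \<le> 1" 
    using c(1) power_le_one[OF c, of "m + 2"] by simp_all
  have "\<bar>1 - c ^ (m + 2) * q\<bar> = \<bar>(1 - c ^ (m + 2)) + c ^ (m + 2) * (1 - q)\<bar>"
    by (simp add: algebra_simps)
  also have "\<dots> \<le> (1 - c ^ (m + 2)) + c ^ (m + 2) * \<bar>1 - q\<bar>"
    using c_pow abs_triangle_ineq[of "1 - c ^ (m + 2)" "c ^ (m + 2) * (1 - q)"]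
    by (simp add: abs_mult del: power_Suc)
  also have "\<dots> \<le> real (m + 2) * t + 1 * (2 * t * (real m)\<^sup>2)"
    using a b c_pow by (intro add_mono mult_mono) auto
  also have "\<dots> \<le> 2 * (real k)\<^sup>2 * t"
  proof -
    have "real (m + 2) + 2 * (real m)\<^sup>2 \<le> 2 * (real k)\<^sup>2"
      by (simp add: Suc power2_eq_square algebra_simps)
    from mult_right_mono[OF this assms(2)] show ?thesis by (simp add: algebra_simps)
  qed
  finally show ?thesis
    unfolding Suc nesterov_residual_eq_gegenbauer[OF assms(1,3)] c_def q_def .
qed

text \<open>
  From $t g_k = 1 - r_k$: one factor $|1-r_k|$ is bounded by $2$, the other by $2k^2t$.
\<close>

lemma nesterov_filter_bound:
  assumes "\<beta> > -1" "0 \<le> t" "t \<le> 1"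
  shows "t * (poly (nesterov_filter (nesterov_weight \<beta>) k) t)\<^sup>2 \<le> (2 * real k)\<^sup>2"
proof (cases "t = 0")
  case False
  define r g where "r = poly (nesterov_residual (nesterov_weight \<beta>) k) t"
    and "g = poly (nesterov_filter (nesterov_weight \<beta>) k) t"
  have tg: "t * g = 1 - r" by (simp add: r_def g_def poly_nesterov_residual)
  have r: "\<bar>1 - r\<bar> \<le> 2 * (real k)\<^sup>2 * t" "\<bar>1 - r\<bar> \<le> 2"
    using one_minus_nesterov_residual_le[OF assms, of k] abs_nesterov_residual_le_1[OF assms, of k]
    by (auto simp: r_def)
  have "t * (t * g\<^sup>2) = \<bar>1 - r\<bar> * \<bar>1 - r\<bar>" by (simp add: power2_eq_square mult_ac flip: tg)
  also have "\<dots> \<le> (2 * (real k)\<^sup>2 * t) * 2" using r assms by (intro mult_mono) auto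
  also have "\<dots> = t * (2 * real k)\<^sup>2" by (simp add: power2_eq_square)
  finally show ?thesis using assms False by (simp add: g_def)
qed simp

text \<open>
  Raise $x/(2a) \le e^{x/(2a)}$ to the power $a$.  The summand $1$ covers $a = 0$, where
  \<^term>\<open>0 powr 0\<close> is $0$.
\<close>

lemma powr_le_exp_half:
  fixes a x :: real
  assumes "a \<ge> 0" "x > 0"
  shows "x powr a \<le> (1 + (2 * a) powr a) * exp (x / 2)"
proof (cases "a = 0")
  case True
  then show ?thesis using assms by simp
next
  case False
  with assms have a: "a > 0" by simp
  have "x / (2 * a) \<le> exp (x / (2 * a))" using exp_ge_add_one_self[of "x / (2 * a)"] by linarith
  then have "(x / (2 * a)) powr a \<le> exp (x / (2 * a)) powr a"
    using a assms by (intro powr_mono2) auto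
  also have "\<dots> = exp (x / 2)" using a by (simp add: exp_powr_real)
  finally have "x powr a \<le> (2 * a) powr a * exp (x / 2)"
    using a by (simp add: powr_divide pos_divide_le_eq mult.commute)
  also have "\<dots> \<le> (1 + (2 * a) powr a) * exp (x / 2)" by (intro mult_right_mono) auto
  finally show ?thesis .
qed

text \<open>
  For $s \le \nu/2$ the amplitude bound with exponent $\nu$ is weakened to the exponent $2s$, which
  cancels $t^s$.  For $s > \nu/2$ it leaves $t^{s-\nu/2} c^k \le t^{s-\nu/2} e^{-kt/2}$, which is $O(k^{-(s-\nu/2)})$.
\<close>

lemma nesterov_residual_decay:
  fixes \<beta> s :: real
  assumes \<beta>: "\<beta> > -1" and s: "s > 0"
  defines "p \<equiv> min (2 * s) (s + (\<beta> + 1) / 4)"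
  obtains C where "C > 0" and "\<And>k t. k \<ge> 1 \<Longrightarrow> 0 \<le> t \<Longrightarrow> t \<le> 1 \<Longrightarrow>
    t powr s * \<bar>poly (nesterov_residual (nesterov_weight \<beta>) k) t\<bar> \<le> C * real k powr (- p)"
proof -
  define \<nu> where "\<nu> = (\<beta> + 1) / 2"
  have \<nu>: "\<nu> > 0" using \<beta> by (simp add: \<nu>_def)
  obtain C0 where C0: "C0 > 0" and decay: "\<And>c s n. 0 \<le> c \<Longrightarrow> 0 < s \<Longrightarrow> c\<^sup>2 + s\<^sup>2 = 1 \<Longrightarrow>
      \<bar>gegenbauer \<nu> c n\<bar> \<le> C0 * ((real n + 1) * s) powr (- \<nu>)"
    using gegenbauer_decay[OF \<nu>] by blast
  define a where "a = s - \<nu> / 2"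
  define C where "C = (1 + C0) + C0 * (1 + (2 * a) powr a)"
  have C: "C > 0" using C0 by (auto simp: C_def intro!: add_pos_nonneg mult_nonneg_nonneg)
  have "t powr s * \<bar>poly (nesterov_residual (nesterov_weight \<beta>) k) t\<bar> \<le> C * real k powr (- p)"
    if k: "k \<ge> 1" and t: "0 \<le> t" "t \<le> 1" for k :: nat and t :: real
  proof (cases "t = 0")
    case True
    then show ?thesis using s C by simp
  next
    case False
    with t have t0: "t > 0" by simp
    obtain m where m: "k = Suc m" using k by (cases k) auto
    define r where "r = \<bar>poly (nesterov_residual (nesterov_weight \<beta>) k) t\<bar>"
    define c where "c = sqrt (1 - t)"
    define y where "y = real k * sqrt t"
    have y: "y > 0" using k t0 by (simp add: y_def)
    have c: "0 \<le> c" "c \<le> 1" "c\<^sup>2 + (sqrt t)\<^sup>2 = 1" using t by (auto simp: c_def)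
    have r1: "0 \<le> r" "r \<le> 1" unfolding r_def using abs_nesterov_residual_le_1[OF \<beta> t] by auto
    have y_powr: "y powr e = real k powr e * t powr (e / 2)" for e
      unfolding y_def using t by (simp add: powr_mult powr_half_sqrt[symmetric] powr_powr)
    have q: "\<bar>gegenbauer \<nu> c m\<bar> \<le> C0 * y powr (- \<nu>)"
      using decay[OF c(1) _ c(3), of m] t0 by (simp add: y_def m add.commute)
    have r: "r \<le> c ^ k * (C0 * y powr (- \<nu>))"
    proof -
      have "r = c ^ Suc k * \<bar>gegenbauer \<nu> c m\<bar>"
        unfolding r_def m nesterov_residual_eq_gegenbauer[OF \<beta> t(2)] \<nu>_def c_def
        using t by (simp add: abs_mult)
      also have "\<dots> \<le> c ^ k * (C0 * y powr (- \<nu>))"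
        using q c by (intro mult_mono power_decreasing) auto
      finally show ?thesis .
    qed
    show ?thesis
    proof (cases "2 * s \<le> \<nu>")
      case True
      then have p: "p = 2 * s" by (simp add: p_def \<nu>_def)
      have "r \<le> (1 + C0) * y powr (- 2 * s)"
      proof (cases "y \<le> 1")
        case True
        have "r \<le> 1 * y powr 0" using r1 y by simp
        also have "\<dots> \<le> (1 + C0) * y powr (- 2 * s)"
          using True y s C0 by (intro mult_mono powr_mono') auto
        finally show ?thesis .
      next
        case False
        have "c ^ k * (C0 * y powr (- \<nu>)) \<le> 1 * ((1 + C0) * y powr (- 2 * s))"
          using False c C0 \<open>2 * s \<le> \<nu>\<close>
          by (intro mult_mono powr_mono power_le_one) auto
        with r show ?thesis by simp
      qed
      then have "t powr s * r \<le> t powr s * ((1 + C0) * y powr (- 2 * s))"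
        by (intro mult_left_mono) auto
      also have "\<dots> = (1 + C0) * real k powr (- p) * (t powr s * t powr (- s))"
        unfolding y_powr p by simp
      also have "t powr s * t powr (- s) = 1" using t0 by (simp flip: powr_add)
      also have "(1 + C0) * real k powr (- p) * 1 \<le> C * real k powr (- p)"
        using C0 by (auto simp: C_def intro!: mult_right_mono)
      finally show ?thesis by (simp add: r_def)
    next
      case False
      then have p: "p = \<nu> + a" by (simp add: p_def \<nu>_def a_def)
      have a: "a \<ge> 0" using False by (simp add: a_def)
      have "c ^ k = sqrt ((1 - t) ^ k)" by (simp add: c_def real_sqrt_power)
      also have "\<dots> \<le> sqrt (exp (- t) ^ k)"
        using t exp_ge_add_one_self[of "- t"] by (intro real_sqrt_le_mono power_mono) auto
      also have "exp (- t) ^ k = (exp (- (real k * t) / 2))\<^sup>2"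
        by (simp flip: exp_of_nat_mult power2_eq_square exp_double)
      finally have ck: "c ^ k \<le> exp (- (real k * t) / 2)" by simp
      have "(real k * t) powr a * c ^ k
          \<le> ((1 + (2 * a) powr a) * exp (real k * t / 2)) * exp (- (real k * t) / 2)"
        using powr_le_exp_half[OF a, of "real k * t"] ck k t0 c
        by (intro mult_mono) auto
      also have "\<dots> = 1 + (2 * a) powr a" by (simp flip: exp_add)
      finally have kt: "(real k * t) powr a * c ^ k \<le> 1 + (2 * a) powr a" .
      have "t powr s * r \<le> t powr s * (c ^ k * (C0 * y powr (- \<nu>)))"
        using r by (intro mult_left_mono) auto
      also have "\<dots> = C0 * real k powr (- \<nu>) * (t powr a * c ^ k)"
        unfolding y_powr a_def by (simp add: powr_diff powr_minus_divide)
      also have "t powr a = (real k * t) powr a * real k powr (- a)"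
        using k by (simp add: powr_mult powr_minus)
      also have "C0 * real k powr (- \<nu>) * ((real k * t) powr a * real k powr (- a) * c ^ k)
          = C0 * ((real k * t) powr a * c ^ k) * real k powr (- p)"
        unfolding p by (simp add: powr_add powr_diff powr_minus_divide mult_ac)
      also have "\<dots> \<le> C * real k powr (- p)"
      proof (rule mult_right_mono)
        have "C0 * ((real k * t) powr a * c ^ k) \<le> C0 * (1 + (2 * a) powr a)"
          using kt C0 by (intro mult_left_mono) auto
        then show "C0 * ((real k * t) powr a * c ^ k) \<le> C" using C0 unfolding C_def by linarith
      qed auto
      finally show ?thesis by (simp add: r_def)
    qed
  qed
  with C show ?thesis by (rule that)
qed

section \<open>Adjoints and coercive operators\<close>

lemma power2_norm_diff_scaleR:
  "(norm (x - e *\<^sub>R y))\<^sup>2 = x \<bullet> x - 2 * e * (y \<bullet> x) + e\<^sup>2 * (y \<bullet> y)"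
proof -
  have "(norm (x - e *\<^sub>R y))\<^sup>2 = x \<bullet> x - e * (x \<bullet> y) - (e * (y \<bullet> x) - e * (e * (y \<bullet> y)))"
    unfolding power2_norm_eq_inner
    by (simp only: inner_diff_left inner_diff_right inner_scaleR_left inner_scaleR_right)
       (simp only: algebra_simps)
  also have "x \<bullet> y = y \<bullet> x" by (rule inner_commute)
  finally show ?thesis by (simp only: power2_eq_square)
qed

text \<open>
  The representing vector is the minimiser of $J(x) = \|x\|^2 - 2\phi(x)$: by the parallelogram identity
  minimising sequences are Cauchy, and minimality along every line is the required identity.
\<close>

lemma riesz_representation:
  fixes \<phi> :: "'a::{real_inner,complete_space} \<Rightarrow> real"
  assumes "bounded_linear \<phi>"
  shows "\<exists>z. \<forall>x. \<phi> x = x \<bullet> z"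
proof -
  interpret \<phi>: bounded_linear \<phi> by fact
  define J where "J x = x \<bullet> x - 2 * \<phi> x" for x
  obtain K where K: "\<And>x. norm (\<phi> x) \<le> norm x * K" using \<phi>.bounded by blast
  have J_ge: "- K\<^sup>2 \<le> J x" for x
  proof -
    have "0 \<le> (norm x - K)\<^sup>2" by simp
    also have "\<dots> = x \<bullet> x - 2 * (norm x * K) + K\<^sup>2"
      by (simp add: power2_diff power2_norm_eq_inner algebra_simps)
    also have "\<dots> \<le> J x + K\<^sup>2" using K[of x] by (simp add: J_def)
    finally show ?thesis by simp
  qed
  then have bdd: "bdd_below (range J)" by (intro bdd_belowI2[of _ "- K\<^sup>2"])
  define m where "m = Inf (range J)"
  have m_le: "m \<le> J x" for x unfolding m_def using bdd by (intro cInf_lower) auto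
  have "\<exists>x. J x < m + inverse (real (Suc n))" for n
  proof -
    have "m < m + inverse (real (Suc n))" by simp
    then show ?thesis unfolding m_def using cInf_lessD[of "range J"] by blast
  qed
  then obtain x where x: "\<And>n. J (x n) < m + inverse (real (Suc n))" by metis
  have parallelogram: "(dist u v)\<^sup>2 \<le> 2 * J u + 2 * J v - 4 * m" for u v
  proof -
    define h where "h = (1/2) *\<^sub>R (u + v)"
    have "(dist u v)\<^sup>2 = 2 * J u + 2 * J v - 4 * J h"
      unfolding h_def dist_norm power2_norm_eq_inner J_def \<phi>.scaleR \<phi>.add
      by (simp add: inner_commute algebra_simps)
    with m_le[of h] show ?thesis by linarith
  qed
  have "Cauchy x"
  proof (rule metric_CauchyI)
    fix e :: real assume e: "e > 0"
    obtain N where N: "inverse (real (Suc N)) < e\<^sup>2 / 4" using reals_Archimedean[of "e\<^sup>2 / 4"] e by auto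
    have "dist (x i) (x j) < e" if "i \<ge> N" "j \<ge> N" for i j
    proof (rule power2_less_imp_less)
      have "inverse (real (Suc i)) \<le> inverse (real (Suc N))" "inverse (real (Suc j)) \<le> inverse (real (Suc N))"
        using that by (auto intro!: le_imp_inverse_le)
      then show "(dist (x i) (x j))\<^sup>2 < e\<^sup>2"
        using parallelogram[of "x i" "x j"] x[of i] x[of j] N by linarith
    qed (use e in simp)
    then show "\<exists>M. \<forall>m\<ge>M. \<forall>n\<ge>M. dist (x m) (x n) < e" by blast
  qed
  then obtain z where z: "x \<longlonglongrightarrow> z" using Cauchy_convergent convergent_def by blast
  have "(\<lambda>n. J (x n)) \<longlonglongrightarrow> J z"
    unfolding J_def by (intro tendsto_intros z \<phi>.tendsto)
  moreover have "(\<lambda>n. m + inverse (real (Suc n))) \<longlonglongrightarrow> m + 0"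
    by (intro tendsto_intros LIMSEQ_inverse_real_of_nat)
  ultimately have "J z \<le> m + 0"
    using x by (intro LIMSEQ_le[of "\<lambda>n. J (x n)"]) (auto intro: less_imp_le)
  have "\<phi> v = v \<bullet> z" for v
  proof (cases "v = 0")
    case False
    define d where "d = v \<bullet> z - \<phi> v"
    define t where "t = - d / (v \<bullet> v)"
    have v: "v \<bullet> v > 0" using False by simp
    have "J z \<le> J (z + t *\<^sub>R v)" using m_le[of "z + t *\<^sub>R v"] \<open>J z \<le> m + 0\<close> by linarith
    also have "\<dots> = J z + (t\<^sup>2 * (v \<bullet> v) + 2 * t * d)"
    proof -
      have "(z + t *\<^sub>R v) \<bullet> (z + t *\<^sub>R v) = z \<bullet> z + 2 * t * (v \<bullet> z) + t\<^sup>2 * (v \<bullet> v)"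
        using power2_norm_diff_scaleR[of z "- t" v] by (simp add: power2_norm_eq_inner)
      then show ?thesis by (simp add: J_def \<phi>.add \<phi>.scaleR d_def right_diff_distrib)
    qed
    also have "t\<^sup>2 * (v \<bullet> v) + 2 * t * d = - (d\<^sup>2 / (v \<bullet> v))"
    proof -
      have "t * (v \<bullet> v) = - d" using v by (simp add: t_def)
      then have "t\<^sup>2 * (v \<bullet> v) + 2 * t * d = t * d" by (simp add: power2_eq_square mult.assoc)
      then show ?thesis by (simp add: t_def power2_eq_square)
    qed
    finally have "d\<^sup>2 / (v \<bullet> v) \<le> 0" by simp
    then show ?thesis using v by (simp add: d_def divide_le_0_iff)
  qed (simp add: \<phi>.zero)
  then show ?thesis by blast
qed

lemma inner_adjoint:
  fixes A :: "'a::{real_inner,complete_space} \<Rightarrow> 'b::real_inner"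
  assumes "bounded_linear A"
  shows "A x \<bullet> y = x \<bullet> adjoint A y"
proof -
  have "\<exists>z. \<forall>x. A x \<bullet> y = x \<bullet> z" for y
    using assms by (intro riesz_representation bounded_linear_inner_left_comp) 
  then have "\<exists>f'. \<forall>x y. A x \<bullet> y = x \<bullet> f' y" by metis
  from someI_ex[OF this] show ?thesis unfolding adjoint_def by blast
qed

lemma bounded_linear_adjoint:
  fixes A :: "'a::{real_inner,complete_space} \<Rightarrow> 'b::real_inner"
  assumes A: "bounded_linear A"
  shows "bounded_linear (adjoint A)"
proof -
  obtain K where K: "\<And>x. norm (A x) \<le> norm x * K"
    using bounded_linear.bounded[OF A] by blast
  show ?thesis
  proof (rule bounded_linear_intro)
    fix u v r
    show "adjoint A (u + v) = adjoint A u + adjoint A v"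
      by (subst vector_eq_ldot[symmetric])
        (simp add: inner_add_right flip: inner_adjoint[OF A])
    show "adjoint A (r *\<^sub>R v) = r *\<^sub>R adjoint A v"
      by (subst vector_eq_ldot[symmetric]) (simp flip: inner_adjoint[OF A])
    have "norm (adjoint A v) * norm (adjoint A v) = A (adjoint A v) \<bullet> v"
      by (simp add: inner_adjoint[OF A] flip: power2_norm_eq_inner power2_eq_square)
    also have "\<dots> \<le> (norm (adjoint A v) * K) * norm v"
      by (rule order_trans[OF norm_cauchy_schwarz]) (intro mult_right_mono K norm_ge_zero)
    finally have "norm (adjoint A v) * norm (adjoint A v) \<le> norm (adjoint A v) * (norm v * K)"
      by (simp add: mult_ac)
    then have "norm (adjoint A v) \<le> norm v * K \<or> adjoint A v = 0"
      by (auto simp: mult_le_cancel_left)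
    moreover have "norm v * K \<le> norm v * \<bar>K\<bar>" by (intro mult_left_mono) auto
    ultimately show "norm (adjoint A v) \<le> norm v * \<bar>K\<bar>" by auto
  qed
qed

text \<open>
  The Lax--Milgram theorem.  For the step size $e = m/K^2$, where $K$ bounds the norm of $S$, the map
  $x \mapsto x - e(Sx - y)$ is a contraction with the solution of $Sx = y$ as its fixed point.
\<close>

lemma coercive_imp_invertible:
  fixes S :: "'a::{real_inner,complete_space} \<Rightarrow> 'a"
  assumes S: "bounded_linear S" and m: "m > 0" and coercive: "\<And>x. m * (x \<bullet> x) \<le> S x \<bullet> x"
  shows "\<exists>R. bounded_linear R \<and> (\<forall>x. R (S x) = x) \<and> (\<forall>x. S (R x) = x)"
proof -
  interpret S: bounded_linear S by fact
  obtain K0 where K0: "K0 > 0" "\<And>x. norm (S x) \<le> norm x * K0" using S.pos_bounded by blast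
  \<comment> \<open>A bound strictly larger than m makes the contraction constant below well defined.\<close>
  define K where "K = K0 + m"
  have K: "K > 0" "m < K" using K0 m by (auto simp: K_def)
  have SK: "S x \<bullet> S x \<le> K\<^sup>2 * (x \<bullet> x)" for x
  proof -
    have "norm (S x) \<le> norm x * K0" by (rule K0)
    also have "\<dots> \<le> norm x * K" using m by (intro mult_left_mono) (auto simp: K_def)
    finally have "(norm (S x))\<^sup>2 \<le> (norm x * K)\<^sup>2" by (rule power_mono) simp
    then show ?thesis by (simp add: power_mult_distrib power2_norm_eq_inner mult.commute)
  qed
  define e where "e = m / K\<^sup>2"
  have e: "e > 0" using m K by (simp add: e_def)
  define c where "c = sqrt (1 - m\<^sup>2 / K\<^sup>2)"
  have mK: "0 < m\<^sup>2 / K\<^sup>2" "m\<^sup>2 / K\<^sup>2 < 1"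
    using m K power_strict_mono[of m K 2] by auto
  then have c: "0 \<le> c" "c < 1" by (auto simp: c_def)
  have contr: "norm (x - e *\<^sub>R S x) \<le> c * norm x" for x
  proof (rule power2_le_imp_le)
    have eq: "e\<^sup>2 * K\<^sup>2 = e * m" "m\<^sup>2 / K\<^sup>2 = e * m"
      using K by (simp_all add: e_def power2_eq_square)
    have "(norm (x - e *\<^sub>R S x))\<^sup>2 = x \<bullet> x - 2 * e * (S x \<bullet> x) + e\<^sup>2 * (S x \<bullet> S x)"
      by (rule power2_norm_diff_scaleR)
    also have "\<dots> \<le> x \<bullet> x - 2 * e * (m * (x \<bullet> x)) + e\<^sup>2 * (K\<^sup>2 * (x \<bullet> x))"
      using e coercive[of x] SK[of x]
      by (intro add_mono diff_mono mult_left_mono) auto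
    also have "e\<^sup>2 * (K\<^sup>2 * (x \<bullet> x)) = e * m * (x \<bullet> x)" by (simp add: mult.assoc[symmetric] eq(1))
    also have "x \<bullet> x - 2 * e * (m * (x \<bullet> x)) + e * m * (x \<bullet> x) = (1 - m\<^sup>2 / K\<^sup>2) * (x \<bullet> x)"
      unfolding eq(2) by (simp add: algebra_simps)
    also have "\<dots> = (c * norm x)\<^sup>2"
      using mK by (simp add: c_def power_mult_distrib power2_norm_eq_inner)
    finally show "(norm (x - e *\<^sub>R S x))\<^sup>2 \<le> (c * norm x)\<^sup>2" .
  qed (use c in simp)
  have surj: "\<exists>x. S x = y" for y
  proof -
    have "\<exists>!x. x - e *\<^sub>R (S x - y) = x"
    proof (rule banach_fix_type[OF c], intro allI)
      fix u v
      have "dist (u - e *\<^sub>R (S u - y)) (v - e *\<^sub>R (S v - y)) = norm ((u - v) - e *\<^sub>R S (u - v))"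
        by (simp add: dist_norm S.diff algebra_simps)
      also have "\<dots> \<le> c * dist u v" unfolding dist_norm by (rule contr)
      finally show "dist (u - e *\<^sub>R (S u - y)) (v - e *\<^sub>R (S v - y)) \<le> c * dist u v" .
    qed
    then show ?thesis using e by auto
  qed
  have below: "m * norm x \<le> norm (S x)" for x
  proof (cases "x = 0")
    case False
    have "x \<bullet> x = norm x * norm x" by (metis power2_norm_eq_inner power2_eq_square)
    then have "(m * norm x) * norm x \<le> norm (S x) * norm x"
      using coercive[of x] norm_cauchy_schwarz[of "S x" x] by (metis mult.assoc order_trans)
    then show ?thesis using False by (metis mult_right_le_imp_le zero_less_norm_iff)
  qed simp
  have inj: "u = v" if "S u = S v" for u v
    using below[of "u - v"] m that by (simp add: S.diff mult_le_0_iff)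
  define R where "R y = (SOME x. S x = y)" for y
  have SR: "S (R y) = y" for y unfolding R_def using someI_ex[OF surj] .
  have RS: "R (S x) = x" for x by (rule inj) (rule SR)
  have "bounded_linear R"
  proof (rule bounded_linear_intro)
    show "R (u + v) = R u + R v" for u v by (rule inj) (simp add: S.add SR)
    show "R (r *\<^sub>R v) = r *\<^sub>R R v" for r v by (rule inj) (simp add: S.scaleR SR)
    show "norm (R y) \<le> norm y * (1 / m)" for y
      using below[of "R y"] m by (simp add: SR field_simps)
  qed
  with SR RS show ?thesis by blast
qed

section \<open>Polynomials of operators\<close>

lemma poly_op_eq_sum:
  assumes "degree p \<le> n"
  shows "poly_op p T x = (\<Sum>i\<le>n. coeff p i *\<^sub>R (T ^^ i) x)"
  unfolding poly_op_def
  by (rule sum.mono_neutral_left) (use assms in \<open>auto simp: coeff_eq_0\<close>)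

lemma poly_op_0 [simp]: "poly_op 0 T x = 0"
  by (simp add: poly_op_def)

lemma poly_op_pCons [simp]:
  assumes "linear T"
  shows "poly_op (pCons a p) T x = a *\<^sub>R x + T (poly_op p T x)"
proof -
  have "poly_op (pCons a p) T x = (\<Sum>i\<le>Suc (degree p). coeff (pCons a p) i *\<^sub>R (T ^^ i) x)"
    by (rule poly_op_eq_sum) (rule degree_pCons_le)
  also have "\<dots> = a *\<^sub>R x + (\<Sum>i\<le>degree p. coeff p i *\<^sub>R T ((T ^^ i) x))"
    by (simp add: sum.atMost_Suc_shift del: sum.atMost_Suc)
  also have "(\<Sum>i\<le>degree p. coeff p i *\<^sub>R T ((T ^^ i) x)) = T (poly_op p T x)"
    by (simp add: poly_op_def linear_sum[OF assms] linear_scale[OF assms])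
  finally show ?thesis .
qed

lemma poly_op_1 [simp]: "poly_op 1 T x = x"
  by (simp add: poly_op_def)

lemma poly_op_add [simp]: "poly_op (p + q) T x = poly_op p T x + poly_op q T x"
proof -
  let ?n = "max (degree p) (degree q)"
  have "degree (p + q) \<le> ?n" by (rule degree_add_le_max)
  then show ?thesis
    by (simp add: poly_op_eq_sum[of _ ?n] scaleR_add_left sum.distrib)
qed

lemma poly_op_smult [simp]: "poly_op (smult a p) T x = a *\<^sub>R poly_op p T x"
  by (simp add: poly_op_eq_sum[of _ "degree p"] scaleR_right.sum)

lemma poly_op_minus [simp]: "poly_op (- p) T x = - poly_op p T x"
  using poly_op_smult[of "-1" p T x] by simp

lemma poly_op_diff [simp]: "poly_op (p - q) T x = poly_op p T x - poly_op q T x"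
  using poly_op_add[of p "- q" T x] by simp

lemma poly_op_mult [simp]:
  assumes "linear T"
  shows "poly_op (p * q) T x = poly_op p T (poly_op q T x)"
  by (induction p) (simp_all add: assms mult_pCons_left)

text \<open>
  Used with $B = A$ or $B = A^*$ to move polynomials between $A^*A$ and $AA^*$, and with $B = T$ to commute $T$ past $p(T)$.
\<close>

lemma poly_op_intertwine:
  assumes "linear B" "linear S" "linear T" "\<And>x. B (T x) = S (B x)"
  shows "B (poly_op p T x) = poly_op p S (B x)"
  by (induction p) (simp_all add: assms linear_0 linear_add linear_scale)

lemma bounded_linear_poly_op:
  assumes "bounded_linear T"
  shows "bounded_linear (poly_op p T)"
proof (induction p)
  case 0
  then show ?case by (simp add: poly_op_def[abs_def] bounded_linear_zero)
next
  case (pCons a p)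
  have "poly_op (pCons a p) T = (\<lambda>x. a *\<^sub>R x + T (poly_op p T x))"
    using assms by (auto simp: bounded_linear.linear)
  then show ?case
    using pCons assms
    by (auto intro!: bounded_linear_add bounded_linear_scaleR_right bounded_linear_compose[of T])
qed

lemma poly_op_self_adjoint:
  assumes "linear T" "\<And>x y. T x \<bullet> y = x \<bullet> T y"
  shows "poly_op p T x \<bullet> y = x \<bullet> poly_op p T y"
proof (induction p arbitrary: x y)
  case (pCons a p)
  have "T (poly_op p T y) = poly_op p T (T y)"
    by (rule poly_op_intertwine) (use assms in auto)
  with pCons show ?case using assms by (simp add: inner_add_left inner_add_right)
qed simp

lemma poly_of_real_add:
  "poly (map_poly of_real (p + q)) (z::complex) = poly (map_poly of_real p) z + poly (map_poly of_real q) z"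
  by (induction p q rule: poly_induct2) (simp_all add: map_poly_pCons algebra_simps)

lemma poly_of_real_smult:
  "poly (map_poly of_real (smult a p)) (z::complex) = of_real a * poly (map_poly of_real p) z"
  by (induction p) (simp_all add: map_poly_pCons algebra_simps)

lemma poly_of_real_mult:
  "poly (map_poly of_real (p * q)) (z::complex) = poly (map_poly of_real p) z * poly (map_poly of_real q) z"
  by (induction p) (simp_all add: map_poly_pCons mult_pCons_left poly_of_real_add poly_of_real_smult algebra_simps)

text \<open>
  The factor belongs to a non-real root and its conjugate; the remainder of the division is a linear real polynomial
  that vanishes at a non-real number, so it is zero.
\<close>

lemma real_poly_without_roots_quadratic_factor:
  fixes h :: "real poly"
  assumes "degree h > 0" and no_root: "\<And>t. poly h t \<noteq> 0"
  obtains a b h' where "b \<noteq> 0" "h = [:a\<^sup>2 + b\<^sup>2, - 2 * a, 1:] * h'"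
proof -
  have "degree (map_poly complex_of_real h) = degree h" by (rule degree_map_poly) simp
  then have "\<not> constant (poly (map_poly complex_of_real h))"
    using assms(1) by (simp add: constant_degree)
  then obtain z where z: "poly (map_poly complex_of_real h) z = 0"
    using fundamental_theorem_of_algebra by blast
  define a b where "a = Re z" and "b = Im z"
  have b: "b \<noteq> 0"
  proof
    assume "b = 0"
    then have "z = of_real a" by (simp add: a_def b_def complex_eq_iff)
    moreover have "poly (map_poly complex_of_real h) (of_real a) = of_real (poly h a)"
      by (induction h) (simp_all add: map_poly_pCons)
    ultimately show False using z no_root by simp
  qed
  define Q where "Q = [:a\<^sup>2 + b\<^sup>2, - 2 * a, 1:]"
  have Q0: "Q \<noteq> 0" "degree Q = 2" by (simp_all add: Q_def)
  have Qz: "poly (map_poly complex_of_real Q) z = 0"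
    by (simp add: Q_def map_poly_pCons a_def b_def complex_eq_iff power2_eq_square algebra_simps)
  define r where "r = h mod Q"
  have h: "h = Q * (h div Q) + r" by (simp add: r_def)
  have "degree r < 2" using degree_mod_less[OF Q0(1), of h] Q0(2) by (auto simp: r_def)
  then have r: "r = [:coeff r 0, coeff r 1:]"
    by (intro poly_eqI) (auto simp: coeff_pCons coeff_eq_0 split: nat.split)
  have "poly (map_poly complex_of_real r) z = 0"
    using z by (subst (asm) h) (simp add: poly_of_real_add poly_of_real_mult Qz)
  then have "of_real (coeff r 0) + z * of_real (coeff r 1) = 0"
    by (subst (asm) r) (simp add: map_poly_pCons)
  then have "coeff r 1 * b = 0" "coeff r 0 + coeff r 1 * a = 0"
    by (simp_all add: complex_eq_iff a_def b_def mult.commute)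
  with b have "coeff r 0 = 0" "coeff r 1 = 0" by auto
  with r have "r = 0" by simp
  with h b show ?thesis by (intro that[of b a "h div Q"]) (simp_all add: Q_def)
qed

lemma bounded_below_compose:
  fixes F G :: "'a::real_normed_vector \<Rightarrow> 'a"
  assumes "\<exists>c>0. \<forall>x. c * norm x \<le> norm (F x)" "\<exists>c>0. \<forall>x. c * norm x \<le> norm (G x)"
  shows "\<exists>c>0. \<forall>x. c * norm x \<le> norm (F (G x))"
proof -
  from assms obtain c d where c: "c > 0" "\<And>x. c * norm x \<le> norm (F x)"
    and d: "d > 0" "\<And>x. d * norm x \<le> norm (G x)" by auto
  have "c * d * norm x \<le> norm (F (G x))" for x
    using mult_left_mono[OF d(2)[of x] less_imp_le[OF c(1)]] c(2)[of "G x"]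
    unfolding mult.assoc by (rule order_trans)
  with c d show ?thesis by (intro exI[of _ "c * d"]) simp
qed

lemma not_in_spectrum_imp_bounded_below:
  assumes "t \<notin> op_spectrum T"
  shows "\<exists>c>0. \<forall>x. c * norm x \<le> norm (T x - t *\<^sub>R x)"
proof -
  from assms obtain S where S: "bounded_linear S" "\<And>x. S (T x - t *\<^sub>R x) = x"
    by (auto simp: op_spectrum_def)
  obtain K where K: "K > 0" "\<And>x. norm (S x) \<le> norm x * K"
    using bounded_linear.pos_bounded[OF S(1)] by blast
  have "1 / K * norm x \<le> norm (T x - t *\<^sub>R x)" for x
    using K(2)[of "T x - t *\<^sub>R x"] K(1) by (simp add: S(2) divide_simps mult.commute)
  with K(1) show ?thesis by (intro exI[of _ "1 / K"]) auto
qed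

text \<open>
  By induction on the degree, splitting off one factor at a time.  A factor $T - t$ with $t$ outside the
  spectrum is bounded below because it has a bounded inverse; a factor $(T-a)^2 + b^2$ with $b \ne 0$ is bounded below by
  self-adjointness, since its quadratic form is $\|(T-a)x\|^2 + b^2\|x\|^2$.
\<close>

lemma poly_op_bounded_below:
  fixes T :: "'a::real_inner \<Rightarrow> 'a"
  assumes T: "linear T" "\<And>x y. T x \<bullet> y = x \<bullet> T y"
    and "h \<noteq> 0" "\<And>t. t \<in> op_spectrum T \<Longrightarrow> poly h t \<noteq> 0"
  shows "\<exists>c>0. \<forall>x. c * norm x \<le> norm (poly_op h T x)"
  using assms(3-)
proof (induction "degree h" arbitrary: h rule: less_induct)
  case less
  show ?case
  proof (cases "\<exists>t. poly h t = 0")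
    case True
    then obtain t where t: "poly h t = 0" by blast
    then obtain h' where h: "h = [:- t, 1:] * h'" by (auto simp: poly_eq_0_iff_dvd elim: dvdE)
    have h': "h' \<noteq> 0" using less.prems h by auto
    have "degree h = Suc (degree h')" unfolding h using h' by (subst degree_mult_eq) auto
    moreover have "poly h' s \<noteq> 0" if "s \<in> op_spectrum T" for s
      using less.prems(2)[OF that] by (simp add: h)
    ultimately have "\<exists>c>0. \<forall>x. c * norm x \<le> norm (poly_op h' T x)"
      using less.hyps[of h'] h' by simp
    moreover have "\<exists>c>0. \<forall>x. c * norm x \<le> norm (T x - t *\<^sub>R x)"
      using t less.prems by (intro not_in_spectrum_imp_bounded_below) auto
    moreover have "poly_op h T x = T (poly_op h' T x) - t *\<^sub>R poly_op h' T x" for x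
      unfolding h poly_op_mult[OF T(1)] by (simp add: T linear_0)
    ultimately show ?thesis
      using bounded_below_compose[of "\<lambda>x. T x - t *\<^sub>R x" "poly_op h' T"] by simp
  next
    case False
    then have no_root: "\<And>t. poly h t \<noteq> 0" by blast
    show ?thesis
    proof (cases "degree h = 0")
      case True
      then obtain a where a: "h = [:a:]" by (rule degree_eq_zeroE)
      with less.prems have "a \<noteq> 0" by simp
      then show ?thesis
        by (intro exI[of _ "\<bar>a\<bar>"]) (simp add: a T linear_0)
    next
      case False
      then obtain a b h' where b: "b \<noteq> 0" and h: "h = [:a\<^sup>2 + b\<^sup>2, - 2 * a, 1:] * h'"
        using real_poly_without_roots_quadratic_factor no_root by (metis gr0I)
      define Q where "Q = [:a\<^sup>2 + b\<^sup>2, - 2 * a, 1:]"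
      have h': "h' \<noteq> 0" using less.prems h by auto
      have "degree h = 2 + degree h'" unfolding h using h' by (subst degree_mult_eq) auto
      moreover have "poly h' s \<noteq> 0" for s
        using no_root[of s] unfolding h poly_mult by auto
      ultimately have "\<exists>c>0. \<forall>x. c * norm x \<le> norm (poly_op h' T x)"
        using less.hyps[of h'] h' by simp
      moreover have "b\<^sup>2 * norm x \<le> norm (poly_op Q T x)" for x
      proof -
        have "poly_op Q T x = (a\<^sup>2 + b\<^sup>2) *\<^sub>R x + (T (T x) - (2 * a) *\<^sub>R T x)"
          by (simp add: Q_def T linear_0 linear_add linear_scale linear_neg linear_diff)
        then have "poly_op Q T x \<bullet> x = (a\<^sup>2 + b\<^sup>2) * (x \<bullet> x) + (T x \<bullet> T x - 2 * a * (T x \<bullet> x))"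
          by (simp add: inner_add_left inner_diff_left T(2))
        also have "\<dots> = (norm (T x - a *\<^sub>R x))\<^sup>2 + b\<^sup>2 * (x \<bullet> x)"
          unfolding power2_norm_diff_scaleR by (simp add: distrib_right inner_commute)
        also have "\<dots> \<ge> b\<^sup>2 * (x \<bullet> x)" by simp
        finally have "b\<^sup>2 * (x \<bullet> x) \<le> norm (poly_op Q T x) * norm x"
          using norm_cauchy_schwarz order_trans by blast
        then have "(b\<^sup>2 * norm x) * norm x \<le> norm (poly_op Q T x) * norm x"
          by (simp add: dot_square_norm power2_eq_square mult.assoc)
        then show ?thesis by (cases "x = 0") auto
      qed
      then have "\<exists>c>0. \<forall>x. c * norm x \<le> norm (poly_op Q T x)"
        using b by (intro exI[of _ "b\<^sup>2"]) simp
      moreover have "poly_op h T x = poly_op Q T (poly_op h' T x)" for x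
        unfolding h Q_def poly_op_mult[OF T(1)] ..
      ultimately show ?thesis
        using bounded_below_compose[of "poly_op Q T" "poly_op h' T"] by simp
    qed
  qed
qed

text \<open>
  With $M = \|S\|$ one has $\|M^2x - S^2x\|^2 \le M^2(M^2\|x\|^2 - \|Sx\|^2)$, and the right-hand side is small relative to
  $\|x\|^2$ for vectors that nearly attain the norm.
\<close>

lemma self_adjoint_norm_square_not_bounded_below:
  fixes S :: "'a::real_inner \<Rightarrow> 'a"
  assumes S: "bounded_linear S" "\<And>x y. S x \<bullet> y = x \<bullet> S y" and "onorm S > 0"
  shows "\<not> (\<exists>c>0. \<forall>x. c * norm x \<le> norm ((onorm S)\<^sup>2 *\<^sub>R x - S (S x)))"
proof
  define M where "M = onorm S"
  have M: "M > 0" using assms by (simp add: M_def)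
  assume "\<exists>c>0. \<forall>x. c * norm x \<le> norm ((onorm S)\<^sup>2 *\<^sub>R x - S (S x))"
  then obtain c0 where c0: "c0 > 0" "\<And>x. c0 * norm x \<le> norm (M\<^sup>2 *\<^sub>R x - S (S x))"
    by (auto simp: M_def)
  \<comment> \<open>Lowering the constant keeps the radicand L nonnegative.\<close>
  define c where "c = min c0 (M\<^sup>2)"
  have c: "c > 0" "c \<le> M\<^sup>2" using c0 M by (auto simp: c_def)
  have below: "c * norm x \<le> norm (M\<^sup>2 *\<^sub>R x - S (S x))" for x
    using c0(2)[of x] mult_right_mono[of c c0 "norm x"] by (simp add: c_def)
  have SM: "norm (S x) \<le> M * norm x" for x unfolding M_def by (rule onorm[OF S(1)])
  define L where "L = M\<^sup>2 - c\<^sup>2 / M\<^sup>2"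
  have "c\<^sup>2 \<le> M\<^sup>2 * M\<^sup>2" using c by (simp add: power2_eq_square mult_mono)
  then have L: "0 \<le> L" "L < M\<^sup>2" using M c by (auto simp: L_def field_simps)
  have "norm (S x) \<le> sqrt L * norm x" for x
  proof (rule power2_le_imp_le)
    have "c\<^sup>2 * (norm x)\<^sup>2 \<le> (norm (M\<^sup>2 *\<^sub>R x - S (S x)))\<^sup>2"
      using power_mono[OF below[of x], of 2] c by (simp add: power_mult_distrib)
    also have "\<dots> = (norm (S (S x) - M\<^sup>2 *\<^sub>R x))\<^sup>2" by (simp add: norm_minus_commute)
    also have "\<dots> = (norm (S (S x)))\<^sup>2 - 2 * M\<^sup>2 * (norm (S x))\<^sup>2 + (M\<^sup>2)\<^sup>2 * (norm x)\<^sup>2"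
      by (subst power2_norm_diff_scaleR) (simp add: power2_norm_eq_inner S(2))
    also have "(norm (S (S x)))\<^sup>2 \<le> M\<^sup>2 * (norm (S x))\<^sup>2"
      using power_mono[OF SM[of "S x"], of 2] by (simp add: power_mult_distrib)
    finally have "c\<^sup>2 * (norm x)\<^sup>2 \<le> M\<^sup>2 * (M\<^sup>2 * (norm x)\<^sup>2 - (norm (S x))\<^sup>2)"
      by (simp add: algebra_simps power2_eq_square)
    then have "c\<^sup>2 / M\<^sup>2 * (norm x)\<^sup>2 \<le> M\<^sup>2 * (norm x)\<^sup>2 - (norm (S x))\<^sup>2"
      using M by (simp add: divide_le_eq mult.commute)
    then have "(norm (S x))\<^sup>2 \<le> L * (norm x)\<^sup>2" by (simp add: L_def algebra_simps)
    also have "\<dots> = (sqrt L * norm x)\<^sup>2" using L by (simp add: power_mult_distrib)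
    finally show "(norm (S x))\<^sup>2 \<le> (sqrt L * norm x)\<^sup>2" .
  qed (use L in simp)
  then have "M \<le> sqrt L" unfolding M_def using L by (intro onorm_bound) auto
  also have "\<dots> < sqrt (M\<^sup>2)" using L by (intro real_sqrt_less_mono)
  finally show False using M by simp
qed

text \<open>
  Let $M = \|p(T)\|$.  Since $M^2 - p(T)^2$ is not bounded below, $M^2 - p^2$ has a root in the spectrum, so
  $|p|$ attains $M$ there.  The exception is a constant $p = \pm M$, for which the argument gives
  nothing; it could only violate the bound if the spectrum were empty, and applying the argument to $p(t) = t$
  instead shows that this happens only on the zero space.
\<close>

lemma norm_poly_op_le:
  fixes T :: "'a::real_inner \<Rightarrow> 'a"
  assumes T: "bounded_linear T" "\<And>x y. T x \<bullet> y = x \<bullet> T y"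
    and C: "0 \<le> C" "\<And>t. t \<in> op_spectrum T \<Longrightarrow> \<bar>poly p t\<bar> \<le> C"
  shows "norm (poly_op p T x) \<le> C * norm x"
proof -
  have linear: "linear T" using T(1) by (rule bounded_linear.linear)
  have root: "\<exists>t\<in>op_spectrum T. poly ([:(onorm (poly_op p T))\<^sup>2:] - p\<^sup>2) t = 0"
    if "onorm (poly_op p T) > 0" "[:(onorm (poly_op p T))\<^sup>2:] - p\<^sup>2 \<noteq> 0" for p
  proof (rule ccontr)
    assume "\<not> ?thesis"
    then have "\<exists>c>0. \<forall>x. c * norm x \<le> norm (poly_op ([:(onorm (poly_op p T))\<^sup>2:] - p\<^sup>2) T x)"
      using that by (intro poly_op_bounded_below linear T(2)) auto
    moreover have "poly_op ([:(onorm (poly_op p T))\<^sup>2:] - p\<^sup>2) T x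
        = (onorm (poly_op p T))\<^sup>2 *\<^sub>R x - poly_op p T (poly_op p T x)" for x
      by (simp add: linear linear_0 power2_eq_square[of p])
    ultimately show False
      using self_adjoint_norm_square_not_bounded_below[OF bounded_linear_poly_op[OF T(1)]
          poly_op_self_adjoint[OF linear T(2)] that(1)] by (simp only:)
  qed
  define M where "M = onorm (poly_op p T)"
  have "M \<le> C"
  proof (rule ccontr)
    assume "\<not> M \<le> C"
    then have M: "M > 0" "M > C" using C by auto
    have no_root: "poly ([:M\<^sup>2:] - p\<^sup>2) t \<noteq> 0" if "t \<in> op_spectrum T" for t
    proof
      assume "poly ([:M\<^sup>2:] - p\<^sup>2) t = 0"
      then have "\<bar>poly p t\<bar> = \<bar>M\<bar>" by (auto simp: power2_eq_iff abs_eq_iff)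
      with C(2)[OF that] M show False by simp
    qed
    then have "[:M\<^sup>2:] - p\<^sup>2 = 0" using root[of p] M by (auto simp: M_def)
    with no_root have empty: "op_spectrum T = {}" by auto
    have "onorm T \<le> 0"
    proof (rule ccontr)
      assume "\<not> onorm T \<le> 0"
      moreover have "poly_op [:0, 1:] T = T" by (auto simp: linear linear_0)
      moreover have "[:(onorm T)\<^sup>2:] - [:0, 1:]\<^sup>2 \<noteq> 0" by (simp add: power2_eq_square)
      ultimately show False using root[of "[:0, 1:]"] empty by auto
    qed
    then have T0: "T x = 0" for x
      using onorm[OF T(1), of x] norm_ge_zero[of x] norm_ge_zero[of "T x"]
      by (metis mult_nonpos_nonneg norm_le_zero_iff order_trans)
    have "0 \<notin> op_spectrum T" using empty by simp
    then have "x = 0" for x :: 'a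
      using not_in_spectrum_imp_bounded_below[of 0 T] by (auto simp: T0 mult_le_0_iff)
    then have "M = onorm (\<lambda>x::'a. 0::'a)"
      unfolding M_def by (intro arg_cong[where f = onorm] ext) blast
    with M show False by (simp add: onorm_zero)
  qed
  have "norm (poly_op p T x) \<le> M * norm x"
    unfolding M_def by (rule onorm[OF bounded_linear_poly_op[OF T(1)]])
  also have "\<dots> \<le> C * norm x" using \<open>M \<le> C\<close> by (intro mult_right_mono) auto
  finally show ?thesis .
qed

section \<open>Functional calculus of positive contractions\<close>

lemma Weierstrass_poly_sequence:
  fixes f :: "real \<Rightarrow> real"
  assumes "continuous_on {0..1} f"
  obtains P :: "nat \<Rightarrow> real poly"
  where "\<And>n t. t \<in> {0..1} \<Longrightarrow> \<bar>poly (P n) t - f t\<bar> \<le> inverse (real (Suc n))"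
proof -
  have "\<exists>p. \<forall>t\<in>{0..1}. \<bar>poly p t - f t\<bar> \<le> inverse (real (Suc n))" for n
  proof -
    obtain g where g: "real_polynomial_function g"
      "\<And>t. t \<in> {0..1} \<Longrightarrow> \<bar>f t - g t\<bar> < inverse (real (Suc n))"
      using Stone_Weierstrass_real_polynomial_function[OF compact_Icc assms, of "inverse (real (Suc n))"]
      by auto
    obtain a m where "g = (\<lambda>t. \<Sum>i\<le>m. a i * t ^ i)"
      using g(1) unfolding real_polynomial_function_iff_sum by blast
    then have "poly (\<Sum>i\<le>m. monom (a i) i) t = g t" for t
      by (simp add: poly_sum poly_monom)
    with g(2) show ?thesis
      by (intro exI[of _ "\<Sum>i\<le>m. monom (a i) i"]) (auto simp: abs_minus_commute intro: less_imp_le)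
  qed
  then show ?thesis using that by metis
qed

text \<open>
  Both $A^*A$ and $AA^*$ are of this kind, and their polynomials are compared through estimates on the common interval $[0,1]$.
\<close>

locale positive_contraction =
  fixes T :: "'a::{real_inner,complete_space} \<Rightarrow> 'a"
  assumes bounded_linear: "bounded_linear T"
    and self_adjoint: "\<And>x y. T x \<bullet> y = x \<bullet> T y"
    and nonneg: "\<And>x. 0 \<le> T x \<bullet> x"
    and norm_le: "\<And>x. norm (T x) \<le> norm x"
begin

lemma linear: "linear T"
  using bounded_linear by (rule bounded_linear.linear)

text \<open>
  For $t < 0$ the operator $T - t$ is coercive, for $t > 1$ the operator $t - T$ is.
\<close>

lemma spectrum_subset: "op_spectrum T \<subseteq> {0..1}"
proof (rule ccontr)
  assume "\<not> ?thesis"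
  then obtain t where "t \<in> op_spectrum T" "t \<notin> {0..1}" by blast
  then have t: "t \<in> op_spectrum T" "t < 0 \<or> t > 1" by auto
  have "\<exists>R. bounded_linear R \<and> (\<forall>x. R (T x - t *\<^sub>R x) = x) \<and> (\<forall>x. T (R x) - t *\<^sub>R R x = x)"
    using t(2)
  proof
    assume t: "t < 0"
    have "bounded_linear (\<lambda>x. T x - t *\<^sub>R x)"
      by (intro bounded_linear_sub bounded_linear bounded_linear_scaleR_right)
    moreover have "- t * (x \<bullet> x) \<le> (T x - t *\<^sub>R x) \<bullet> x" for x
      using nonneg[of x] by (simp add: inner_diff_left)
    ultimately show ?thesis using coercive_imp_invertible[of "\<lambda>x. T x - t *\<^sub>R x" "- t"] t by simp
  next
    assume t: "t > 1"
    have "bounded_linear (\<lambda>x. t *\<^sub>R x - T x)"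
      by (intro bounded_linear_sub bounded_linear bounded_linear_scaleR_right)
    moreover have "(t - 1) * (x \<bullet> x) \<le> (t *\<^sub>R x - T x) \<bullet> x" for x
    proof -
      have "T x \<bullet> x \<le> norm x * norm x"
        using norm_cauchy_schwarz[of "T x" x] mult_right_mono[OF norm_le[of x] norm_ge_zero[of x]]
        by (rule order_trans)
      then show ?thesis
        by (simp add: inner_diff_left dot_square_norm power2_eq_square left_diff_distrib)
    qed
    ultimately obtain R where R: "bounded_linear R" "\<And>x. R (t *\<^sub>R x - T x) = x"
        "\<And>x. t *\<^sub>R R x - T (R x) = x"
      using coercive_imp_invertible[of "\<lambda>x. t *\<^sub>R x - T x" "t - 1"] t by auto
    interpret R: bounded_linear R by (rule R)
    have "bounded_linear (\<lambda>x. - R x)" using R(1) by (rule bounded_linear_minus)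
    moreover have "- R (T x - t *\<^sub>R x) = x" for x
      using R(2)[of x] by (simp add: R.diff)
    moreover have "T (- R x) - t *\<^sub>R (- R x) = x" for x
      using R(3)[of x] by (simp add: linear_neg[OF linear])
    ultimately show ?thesis by blast
  qed
  with t(1) show False unfolding op_spectrum_def by blast
qed

lemma norm_poly_op_le_unit_interval:
  assumes "\<And>t. 0 \<le> t \<Longrightarrow> t \<le> 1 \<Longrightarrow> \<bar>poly p t\<bar> \<le> C"
  shows "norm (poly_op p T x) \<le> C * norm x"
proof (rule norm_poly_op_le[OF bounded_linear self_adjoint])
  show "0 \<le> C" using assms[of 0] by simp
  show "\<bar>poly p t\<bar> \<le> C" if "t \<in> op_spectrum T" for t
    using spectrum_subset that by (intro assms) auto
qed

text \<open>
  If $m \le p \le M$ on $[0,1]$, then $\frac{M+m}2 - p$ is at most $\frac{M-m}2$ in absolute value, and the norm bound for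
  this polynomial is the lower bound for the form of $p(T)$.
\<close>

lemma poly_op_inner_ge:
  assumes "\<And>t. 0 \<le> t \<Longrightarrow> t \<le> 1 \<Longrightarrow> m \<le> poly p t"
  shows "m * (x \<bullet> x) \<le> poly_op p T x \<bullet> x"
proof -
  have "compact (poly p ` {0..1})"
    by (intro compact_continuous_image continuous_intros) simp
  then obtain M where M: "\<And>t. 0 \<le> t \<Longrightarrow> t \<le> 1 \<Longrightarrow> poly p t \<le> M"
    using compact_imp_bounded[THEN bounded_imp_bdd_above] unfolding bdd_above_def by force
  define q where "q = [:(M + m) / 2:] - p"
  have "\<bar>poly q t\<bar> \<le> (M - m) / 2" if "0 \<le> t" "t \<le> 1" for t
    using M[OF that] assms[OF that] by (simp add: q_def abs_le_iff field_simps)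
  then have "norm (poly_op q T x) \<le> (M - m) / 2 * norm x"
    by (rule norm_poly_op_le_unit_interval)
  then have "norm (poly_op q T x) * norm x \<le> (M - m) / 2 * norm x * norm x"
    by (rule mult_right_mono) simp
  then have "poly_op q T x \<bullet> x \<le> (M - m) / 2 * (x \<bullet> x)"
    using norm_cauchy_schwarz[of "poly_op q T x" x]
    by (simp add: dot_square_norm power2_eq_square mult.assoc)
  moreover have "poly_op q T x \<bullet> x = (M + m) / 2 * (x \<bullet> x) - poly_op p T x \<bullet> x"
    by (simp add: q_def linear linear_0 inner_diff_left)
  ultimately show ?thesis by (simp add: field_simps)
qed

lemma poly_op_quadratic_form_le:
  assumes "\<And>t. 0 \<le> t \<Longrightarrow> t \<le> 1 \<Longrightarrow> t * (poly p t)\<^sup>2 \<le> C"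
  shows "T (poly_op p T x) \<bullet> poly_op p T x \<le> C * (x \<bullet> x)"
proof -
  have "- C * (x \<bullet> x) \<le> poly_op (- pCons 0 (p * p)) T x \<bullet> x"
    by (rule poly_op_inner_ge) (use assms in \<open>simp add: power2_eq_square\<close>)
  also have "poly_op (- pCons 0 (p * p)) T x \<bullet> x = - (T (poly_op p T (poly_op p T x)) \<bullet> x)"
    by (simp add: linear del: minus_pCons)
  also have "T (poly_op p T (poly_op p T x)) = poly_op p T (T (poly_op p T x))"
    by (rule poly_op_intertwine) (auto simp: linear)
  also have "poly_op p T (T (poly_op p T x)) \<bullet> x = T (poly_op p T x) \<bullet> poly_op p T x"
    by (rule poly_op_self_adjoint[OF linear self_adjoint])
  finally show ?thesis by simp
qed

text \<open>
  One approximating sequence on $[0,1]$ defines the limit operator pointwise; any other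
  sequence that converges to $f$ on the spectrum has the same limit by the norm inequality.
\<close>

lemma poly_op_uniform_limit:
  assumes f: "continuous_on {0..1} f"
  obtains B where "bounded_linear B"
    and "\<And>p. uniform_limit (op_spectrum T) (\<lambda>n. poly (p n)) f sequentially \<Longrightarrow>
      (\<lambda>n. onorm (\<lambda>x. poly_op (p n) T x - B x)) \<longlonglongrightarrow> 0"
proof -
  obtain P where P: "\<And>n t. t \<in> {0..1} \<Longrightarrow> \<bar>poly (P n) t - f t\<bar> \<le> inverse (real (Suc n))"
    using Weierstrass_poly_sequence[OF f] by blast
  have close: "norm (poly_op p T x - poly_op (P m) T x) \<le> (e + inverse (real (Suc m))) * norm x"
    if "e \<ge> 0" "\<And>t. t \<in> op_spectrum T \<Longrightarrow> \<bar>poly p t - f t\<bar> \<le> e" for p e m x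
  proof -
    have "norm (poly_op (p - P m) T x) \<le> (e + inverse (real (Suc m))) * norm x"
    proof (rule norm_poly_op_le[OF bounded_linear self_adjoint])
      show "\<bar>poly (p - P m) t\<bar> \<le> e + inverse (real (Suc m))" if t: "t \<in> op_spectrum T" for t
        using \<open>\<And>t. t \<in> op_spectrum T \<Longrightarrow> \<bar>poly p t - f t\<bar> \<le> e\<close>[OF t] P[of t m] spectrum_subset t
        by fastforce
    qed (use that in simp)
    then show ?thesis by simp
  qed
  have P': "\<bar>poly (P n) t - f t\<bar> \<le> inverse (real (Suc n))" if "t \<in> op_spectrum T" for n t
    using P that spectrum_subset by blast
  have inv0: "(\<lambda>m. inverse (real (Suc m))) \<longlonglongrightarrow> 0" by (rule LIMSEQ_inverse_real_of_nat)
  have "Cauchy (\<lambda>n. poly_op (P n) T x)" for x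
  proof (rule metric_CauchyI)
    fix e :: real assume e: "e > 0"
    define b where "b = norm x + 1"
    have b: "b > 0" by (simp add: b_def add_nonneg_pos)
    define e' where "e' = e / (2 * b)"
    have "e' > 0" using e b by (simp add: e'_def)
    then obtain N where N: "inverse (real (Suc N)) < e'" using reals_Archimedean by blast
    have "dist (poly_op (P i) T x) (poly_op (P j) T x) < e" if "i \<ge> N" "j \<ge> N" for i j
    proof -
      have "inverse (real (Suc i)) \<le> inverse (real (Suc N))" "inverse (real (Suc j)) \<le> inverse (real (Suc N))"
        using that by (auto intro!: le_imp_inverse_le)
      then have ij: "inverse (real (Suc i)) + inverse (real (Suc j)) \<le> 2 * e'" using N by linarith
      have "dist (poly_op (P i) T x) (poly_op (P j) T x)
          \<le> (inverse (real (Suc i)) + inverse (real (Suc j))) * norm x"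
        unfolding dist_norm by (rule close) (simp, rule P')
      also have "\<dots> \<le> 2 * e' * norm x" using ij by (intro mult_right_mono) auto
      also have "\<dots> < 2 * e' * b" using \<open>e' > 0\<close> by (simp add: b_def)
      also have "\<dots> = e" using b by (simp add: e'_def)
      finally show ?thesis .
    qed
    then show "\<exists>M. \<forall>m\<ge>M. \<forall>n\<ge>M. dist (poly_op (P m) T x) (poly_op (P n) T x) < e" by blast
  qed
  then have "\<exists>L. (\<lambda>n. poly_op (P n) T x) \<longlonglongrightarrow> L" for x
    using Cauchy_convergent convergent_def by blast
  then obtain B where B: "\<And>x. (\<lambda>n. poly_op (P n) T x) \<longlonglongrightarrow> B x" by metis
  have close_B: "norm (poly_op p T x - B x) \<le> e * norm x"
    if "e \<ge> 0" "\<And>t. t \<in> op_spectrum T \<Longrightarrow> \<bar>poly p t - f t\<bar> \<le> e" for p e x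
  proof (rule LIMSEQ_le)
    show "(\<lambda>m. norm (poly_op p T x - poly_op (P m) T x)) \<longlonglongrightarrow> norm (poly_op p T x - B x)"
      by (intro tendsto_intros B)
    show "(\<lambda>m. (e + inverse (real (Suc m))) * norm x) \<longlonglongrightarrow> e * norm x"
      using tendsto_mult_right[OF tendsto_add[OF tendsto_const inv0]] by (simp add: add_0_right)
    show "\<exists>N. \<forall>m\<ge>N. norm (poly_op p T x - poly_op (P m) T x) \<le> (e + inverse (real (Suc m))) * norm x"
      using close[OF that] by blast
  qed
  have bl: "bounded_linear (poly_op p T)" for p
    by (rule bounded_linear_poly_op[OF bounded_linear])
  have "bounded_linear B"
  proof (rule bounded_linear_intro)
    fix x y r
    show "B (x + y) = B x + B y"
      using B[of "x + y"] tendsto_add[OF B[of x] B[of y]]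
      by (intro LIMSEQ_unique) (simp_all add: linear_add[OF bounded_linear.linear[OF bl]])
    show "B (r *\<^sub>R x) = r *\<^sub>R B x"
      using B[of "r *\<^sub>R x"] tendsto_scaleR[OF tendsto_const B[of x], of r]
      by (intro LIMSEQ_unique) (simp_all add: linear_scale[OF bounded_linear.linear[OF bl]])
    have "norm (poly_op (P 0) T x - B x) \<le> inverse (real (Suc 0)) * norm x"
      by (rule close_B) (simp, rule P')
    moreover have "norm (poly_op (P 0) T x) \<le> onorm (poly_op (P 0) T) * norm x"
      by (rule onorm[OF bl])
    moreover have "norm (B x) \<le> norm (poly_op (P 0) T x) + norm (poly_op (P 0) T x - B x)"
      by (metis norm_minus_commute norm_triangle_sub)
    ultimately show "norm (B x) \<le> norm x * (onorm (poly_op (P 0) T) + 1)"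
      by (simp add: algebra_simps)
  qed
  moreover have "(\<lambda>n. onorm (\<lambda>x. poly_op (p n) T x - B x)) \<longlonglongrightarrow> 0"
    if p: "uniform_limit (op_spectrum T) (\<lambda>n. poly (p n)) f sequentially" for p
  proof (rule LIMSEQ_I)
    fix e :: real assume e: "e > 0"
    then have "\<forall>\<^sub>F n in sequentially. \<forall>t\<in>op_spectrum T. dist (poly (p n) t) (f t) < e / 2"
      using uniform_limitD[OF p, of "e / 2"] by simp
    then obtain N where N: "\<And>n t. n \<ge> N \<Longrightarrow> t \<in> op_spectrum T \<Longrightarrow> \<bar>poly (p n) t - f t\<bar> < e / 2"
      by (auto simp: eventually_at_top_linorder dist_real_def)
    have "norm (onorm (\<lambda>x. poly_op (p n) T x - B x) - 0) < e" if "n \<ge> N" for n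
    proof -
      have "onorm (\<lambda>x. poly_op (p n) T x - B x) \<le> e / 2"
      proof (rule onorm_bound)
        show "norm (poly_op (p n) T x - B x) \<le> e / 2 * norm x" for x
          using e N[OF that] by (intro close_B) (auto intro: less_imp_le)
      qed (use e in simp)
      moreover have "0 \<le> onorm (\<lambda>x. poly_op (p n) T x - B x)"
        by (intro onorm_pos_le bounded_linear_sub bl \<open>bounded_linear B\<close>)
      ultimately show ?thesis using e by simp
    qed
    then show "\<exists>no. \<forall>n\<ge>no. norm (onorm (\<lambda>x. poly_op (p n) T x - B x) - 0) < e" by blast
  qed
  ultimately show ?thesis by (rule that)
qed

text \<open>
  The approximants converge on all of $[0,1]$, so that later estimates can be made there without reference to the spectrum.
\<close>

lemma functional_calculus_approximation:
  assumes f: "continuous_on {0..1} f"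
  obtains P where "\<And>n t. 0 \<le> t \<Longrightarrow> t \<le> 1 \<Longrightarrow> \<bar>poly (P n) t - f t\<bar> \<le> inverse (real (Suc n))"
    and "\<And>x. (\<lambda>n. poly_op (P n) T x) \<longlonglongrightarrow> functional_calculus f T x"
proof -
  obtain P where P: "\<And>n t. t \<in> {0..1} \<Longrightarrow> \<bar>poly (P n) t - f t\<bar> \<le> inverse (real (Suc n))"
    using Weierstrass_poly_sequence[OF f] by blast
  have lim_P: "uniform_limit (op_spectrum T) (\<lambda>n. poly (P n)) f sequentially"
  proof (rule uniform_limitI)
    fix e :: real assume "e > 0"
    then obtain N where N: "inverse (real (Suc N)) < e" using reals_Archimedean by blast
    have "dist (poly (P n) t) (f t) < e" if "n \<ge> N" "t \<in> op_spectrum T" for n t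
    proof -
      have "dist (poly (P n) t) (f t) \<le> inverse (real (Suc n))"
        using P spectrum_subset that(2) by (auto simp: dist_real_def)
      also have "\<dots> \<le> inverse (real (Suc N))" using that by (auto intro!: le_imp_inverse_le)
      finally show ?thesis using N by simp
    qed
    then show "\<forall>\<^sub>F n in sequentially. \<forall>t\<in>op_spectrum T. dist (poly (P n) t) (f t) < e"
      by (auto simp: eventually_at_top_linorder)
  qed
  have pointwise: "(\<lambda>n. poly_op (P n) T x) \<longlonglongrightarrow> B x"
    if B: "bounded_linear B" "(\<lambda>n. onorm (\<lambda>x. poly_op (P n) T x - B x)) \<longlonglongrightarrow> 0" for B x
  proof -
    have "(\<lambda>n. onorm (\<lambda>x. poly_op (P n) T x - B x) * norm x) \<longlonglongrightarrow> 0 * norm x"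
      by (intro tendsto_intros B)
    then have lim: "(\<lambda>n. onorm (\<lambda>x. poly_op (P n) T x - B x) * norm x) \<longlonglongrightarrow> 0"
      by (simp only: mult_zero_left)
    have bl: "bounded_linear (\<lambda>x. poly_op (P n) T x - B x)" for n
      using bounded_linear_poly_op[OF bounded_linear] B(1) by (rule bounded_linear_sub)
    have "(\<lambda>n. poly_op (P n) T x - B x) \<longlonglongrightarrow> 0"
      using onorm[OF bl] by (intro Lim_null_comparison[OF always_eventually lim]) blast
    then show ?thesis by (rule LIM_zero_cancel)
  qed
  obtain B where B: "bounded_linear B"
    "\<And>p. uniform_limit (op_spectrum T) (\<lambda>n. poly (p n)) f sequentially \<Longrightarrow>
      (\<lambda>n. onorm (\<lambda>x. poly_op (p n) T x - B x)) \<longlonglongrightarrow> 0"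
    using poly_op_uniform_limit[OF f] by blast
  have "functional_calculus f T = B"
    unfolding functional_calculus_def
  proof (rule the_equality)
    fix B'
    assume B': "bounded_linear B' \<and> (\<forall>p. uniform_limit (op_spectrum T) (\<lambda>n. poly (p n)) f sequentially \<longrightarrow>
        (\<lambda>n. onorm (\<lambda>x. poly_op (p n) T x - B' x)) \<longlonglongrightarrow> 0)"
    show "B' = B"
    proof
      fix x
      show "B' x = B x"
        using pointwise[of B' x] pointwise[of B x] B' B lim_P by (intro LIMSEQ_unique) blast+
    qed
  qed (use B in blast)
  with pointwise[OF B(1) B(2)[OF lim_P]] P show ?thesis by (intro that[of P]) auto
qed

end

section \<open>Powers in source conditions\<close>

context positive_contraction
begin

text \<open>
  Both the decay of $\|A r(T) x^\dagger\|$ and the interpolation inequality are lower bounds for a form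
  $\langle w(T)v, v\rangle$ with $v = r(T)T^\mu\omega$ and a polynomial weight $w$.  Such a bound follows from the one for
  polynomials, applied to $w r^2 P_n^2$ with $P_n$ approximating $t^\mu$, by passing to the limit.
\<close>

lemma poly_op_op_powr_inner_ge:
  assumes \<mu>: "\<mu> > 0"
    and m: "\<And>t. 0 \<le> t \<Longrightarrow> t \<le> 1 \<Longrightarrow> m \<le> poly w t * (poly r t)\<^sup>2 * t powr (2 * \<mu>)"
  defines "v \<equiv> \<lambda>\<omega>. poly_op r T (op_powr T \<mu> \<omega>)"
  shows "m * (\<omega> \<bullet> \<omega>) \<le> poly_op w T (v \<omega>) \<bullet> v \<omega>"
proof -
  have "continuous_on {0..1} (\<lambda>t::real. t powr \<mu>)"
    using \<mu> by (intro continuous_on_powr') (auto intro!: continuous_intros)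
  then obtain P where P: "\<And>n t. 0 \<le> t \<Longrightarrow> t \<le> 1 \<Longrightarrow> \<bar>poly (P n) t - t powr \<mu>\<bar> \<le> inverse (real (Suc n))"
    and lim: "\<And>x. (\<lambda>n. poly_op (P n) T x) \<longlonglongrightarrow> op_powr T \<mu> x"
    unfolding op_powr_def by (rule functional_calculus_approximation) blast
  have "compact (poly (w * r\<^sup>2) ` {0..1})"
    by (intro compact_continuous_image continuous_intros) simp
  then obtain W where W: "W > 0" "\<And>t. 0 \<le> t \<Longrightarrow> t \<le> 1 \<Longrightarrow> \<bar>poly (w * r\<^sup>2) t\<bar> \<le> W"
    using compact_imp_bounded bounded_pos by (metis (no_types, lifting) atLeastAtMost_iff imageI real_norm_def)
  define e where "e n = inverse (real (Suc n))" for n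
  have e: "0 < e n" "e n \<le> 1" for n by (auto simp: e_def intro!: inverse_le_1_iff[THEN iffD2])
  have bl: "bounded_linear (poly_op p T)" for p by (rule bounded_linear_poly_op[OF bounded_linear])
  define q where "q n = r * P n" for n
  have lower: "(m - W * (3 * e n)) * (\<omega> \<bullet> \<omega>) \<le> poly_op w T (poly_op (q n) T \<omega>) \<bullet> poly_op (q n) T \<omega>" for n
  proof -
    have "(m - W * (3 * e n)) * (\<omega> \<bullet> \<omega>) \<le> poly_op (q n * (w * q n)) T \<omega> \<bullet> \<omega>"
    proof (rule poly_op_inner_ge)
      fix t :: real assume t: "0 \<le> t" "t \<le> 1"
      define f a where "f = t powr \<mu>" and "a = poly (P n) t"
      have f: "0 \<le> f" "f \<le> 1" using t \<mu> powr_mono2[of \<mu> t 1] by (auto simp: f_def)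
      have f2: "f\<^sup>2 = t powr (2 * \<mu>)" unfolding f_def power2_eq_square by (simp flip: powr_add)
      have af: "\<bar>a - f\<bar> \<le> e n" using P[OF t] by (simp add: a_def f_def e_def)
      have "\<bar>a\<^sup>2 - f\<^sup>2\<bar> = \<bar>a - f\<bar> * \<bar>a + f\<bar>"
        unfolding abs_mult[symmetric] by (simp add: power2_eq_square algebra_simps)
      also have "\<dots> \<le> e n * 3"
        using af f e[of n] by (intro mult_mono) auto
      finally have "\<bar>poly (w * r\<^sup>2) t * (a\<^sup>2 - f\<^sup>2)\<bar> \<le> W * (3 * e n)"
        unfolding abs_mult using W(2)[OF t] W(1) by (intro mult_mono) auto
      moreover have "m \<le> poly (w * r\<^sup>2) t * f\<^sup>2" using m[OF t] by (simp add: f2)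
      moreover have "poly (q n * (w * q n)) t = poly (w * r\<^sup>2) t * f\<^sup>2 + poly (w * r\<^sup>2) t * (a\<^sup>2 - f\<^sup>2)"
        by (simp add: q_def a_def power2_eq_square algebra_simps)
      ultimately show "m - W * (3 * e n) \<le> poly (q n * (w * q n)) t" by linarith
    qed
    also have "poly_op (q n * (w * q n)) T \<omega> = poly_op (q n) T (poly_op w T (poly_op (q n) T \<omega>))"
      by (simp only: poly_op_mult[OF linear])
    finally show ?thesis unfolding poly_op_self_adjoint[OF linear self_adjoint, of "q n"] .
  qed
  have v: "(\<lambda>n. poly_op (q n) T \<omega>) \<longlonglongrightarrow> v \<omega>"
    unfolding q_def v_def poly_op_mult[OF linear]
    by (intro bounded_linear.tendsto[OF bl] lim)
  have e0: "e \<longlonglongrightarrow> 0" unfolding e_def by (rule LIMSEQ_inverse_real_of_nat)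
  have "(\<lambda>n. (m - W * (3 * e n)) * (\<omega> \<bullet> \<omega>)) \<longlonglongrightarrow> (m - W * (3 * 0)) * (\<omega> \<bullet> \<omega>)"
    by (intro tendsto_intros e0)
  moreover have "(\<lambda>n. poly_op w T (poly_op (q n) T \<omega>) \<bullet> poly_op (q n) T \<omega>) \<longlonglongrightarrow> poly_op w T (v \<omega>) \<bullet> v \<omega>"
    by (intro tendsto_inner bounded_linear.tendsto[OF bl] v)
  ultimately have "(m - W * (3 * 0)) * (\<omega> \<bullet> \<omega>) \<le> poly_op w T (v \<omega>) \<bullet> v \<omega>"
    using lower by (intro LIMSEQ_le) auto
  then show ?thesis by simp
qed

text \<open>
  Here $\langle Tv,v\rangle$ takes the place of $\|T^{1/2}v\|^2$; the weight is $w(t) = -t$.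
\<close>

lemma source_condition_decay:
  assumes \<mu>: "\<mu> > 0"
    and C: "\<And>t. 0 \<le> t \<Longrightarrow> t \<le> 1 \<Longrightarrow> t powr (\<mu> + 1/2) * \<bar>poly r t\<bar> \<le> C"
  defines "v \<equiv> \<lambda>\<omega>. poly_op r T (op_powr T \<mu> \<omega>)"
  shows "T (v \<omega>) \<bullet> v \<omega> \<le> C\<^sup>2 * (\<omega> \<bullet> \<omega>)"
proof -
  have "- C\<^sup>2 * (\<omega> \<bullet> \<omega>) \<le> poly_op [:0, -1:] T (v \<omega>) \<bullet> v \<omega>"
    unfolding v_def
  proof (rule poly_op_op_powr_inner_ge[OF \<mu>])
    fix t :: real assume t: "0 \<le> t" "t \<le> 1"
    have "(t powr (\<mu> + 1/2) * \<bar>poly r t\<bar>)\<^sup>2 \<le> C\<^sup>2" by (rule power_mono[OF C[OF t]]) simp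
    moreover have "(t powr (\<mu> + 1/2))\<^sup>2 = t powr (2 * \<mu> + 1)"
      unfolding power2_eq_square by (simp flip: powr_add)
    moreover have "t powr (2 * \<mu> + 1) = t powr (2 * \<mu>) * t" using t by (simp add: powr_add)
    ultimately show "- C\<^sup>2 \<le> poly [:0, -1:] t * (poly r t)\<^sup>2 * t powr (2 * \<mu>)"
      by (simp add: power_mult_distrib mult_ac)
  qed
  then show ?thesis by (simp add: linear linear_0 linear_neg)
qed

text \<open>
  This replaces the interpolation inequality for $\|T^\mu r(T)\omega\|$ by its form with a free parameter:
  $t^{2\mu} \le t^{2\mu+1}/\epsilon + \epsilon^{2\mu}$, where the first term suffices for $t \ge \epsilon$ and the second for
  $t < \epsilon$.  The weight is $w(t) = t/\epsilon - 1$.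
\<close>

lemma source_condition_interpolation:
  assumes \<mu>: "\<mu> > 0" and \<epsilon>: "\<epsilon> > 0"
    and r: "\<And>t. 0 \<le> t \<Longrightarrow> t \<le> 1 \<Longrightarrow> \<bar>poly r t\<bar> \<le> 1"
  defines "v \<equiv> \<lambda>\<omega>. poly_op r T (op_powr T \<mu> \<omega>)"
  shows "v \<omega> \<bullet> v \<omega> \<le> (T (v \<omega>) \<bullet> v \<omega>) / \<epsilon> + \<epsilon> powr (2 * \<mu>) * (\<omega> \<bullet> \<omega>)"
proof -
  have "- (\<epsilon> powr (2 * \<mu>)) * (\<omega> \<bullet> \<omega>) \<le> poly_op [:-1, 1 / \<epsilon>:] T (v \<omega>) \<bullet> v \<omega>"
    unfolding v_def
  proof (rule poly_op_op_powr_inner_ge[OF \<mu>])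
    fix t :: real assume t: "0 \<le> t" "t \<le> 1"
    have r2: "0 \<le> (poly r t)\<^sup>2" "(poly r t)\<^sup>2 \<le> 1" using r[OF t] by (auto simp: abs_square_le_1)
    show "- (\<epsilon> powr (2 * \<mu>)) \<le> poly [:-1, 1 / \<epsilon>:] t * (poly r t)\<^sup>2 * t powr (2 * \<mu>)"
    proof (cases "t \<ge> \<epsilon>")
      case True
      then have "0 \<le> poly [:-1, 1 / \<epsilon>:] t * (poly r t)\<^sup>2 * t powr (2 * \<mu>)"
        using \<epsilon> r2 by (intro mult_nonneg_nonneg) (auto simp: field_simps)
      moreover have "- (\<epsilon> powr (2 * \<mu>)) \<le> 0" by simp
      ultimately show ?thesis by linarith
    next
      case False
      have "(1 - t / \<epsilon>) * (poly r t)\<^sup>2 * t powr (2 * \<mu>) \<le> 1 * 1 * \<epsilon> powr (2 * \<mu>)"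
        using False t \<epsilon> r2 \<mu> by (intro mult_mono powr_mono2) auto
      moreover have "poly [:-1, 1 / \<epsilon>:] t = - (1 - t / \<epsilon>)" by simp
      ultimately show ?thesis by (simp only: mult_minus_left neg_le_iff_le mult_1_left)
    qed
  qed
  then show ?thesis by (simp add: linear linear_0 linear_scale inner_diff_left inner_add_left)
qed

end

section \<open>The Nesterov iteration in terms of its polynomials\<close>

locale contractive_normal_operator =
  fixes A :: "'a::{real_inner,complete_space} \<Rightarrow> 'b::{real_inner,complete_space}"
  assumes bounded_linear_A: "bounded_linear A"
    and onorm_normal: "onorm (adjoint A \<circ> A) < 1"
begin

definition T where "T = adjoint A \<circ> A"
definition S where "S = A \<circ> adjoint A"

lemma bounded_linear_T: "bounded_linear T"
  unfolding T_def o_def using bounded_linear_adjoint[OF bounded_linear_A] bounded_linear_A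
  by (rule bounded_linear_compose)

lemma bounded_linear_S: "bounded_linear S"
  unfolding S_def o_def using bounded_linear_A bounded_linear_adjoint[OF bounded_linear_A]
  by (rule bounded_linear_compose)

lemma linear_A: "linear A" "linear (adjoint A)"
  using bounded_linear_A bounded_linear_adjoint by (auto intro: bounded_linear.linear)

lemma inner_T: "T x \<bullet> y = A x \<bullet> A y"
  using inner_adjoint[OF bounded_linear_A, of y "A x"] by (simp add: T_def inner_commute)

lemma inner_S: "S x \<bullet> y = adjoint A x \<bullet> adjoint A y"
  using inner_adjoint[OF bounded_linear_A, of "adjoint A x" y] by (simp add: S_def)

lemma norm_A_le: "norm (A x) \<le> norm x"
proof (rule power2_le_imp_le)
  have "norm (T x) \<le> onorm T * norm x" by (rule onorm[OF bounded_linear_T])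
  also have "\<dots> \<le> 1 * norm x" using onorm_normal by (intro mult_right_mono) (auto simp: T_def)
  finally have "norm (T x) * norm x \<le> norm x * norm x" by (intro mult_right_mono) auto
  then show "(norm (A x))\<^sup>2 \<le> (norm x)\<^sup>2"
    using norm_cauchy_schwarz[of "T x" x] by (simp add: inner_T dot_square_norm power2_eq_square)
qed simp

text \<open>
  From $\|A^*y\|^2 = \langle AA^*y, y\rangle$ and the bound for $A$, so that $AA^*$ is a contraction as well although only
  $A^*A$ is assumed to be one.
\<close>

lemma norm_adjoint_le: "norm (adjoint A y) \<le> norm y"
proof -
  have "norm (adjoint A y) * norm (adjoint A y) = A (adjoint A y) \<bullet> y"
    by (simp add: inner_adjoint[OF bounded_linear_A] dot_square_norm power2_eq_square)
  also have "\<dots> \<le> norm (A (adjoint A y)) * norm y" by (rule norm_cauchy_schwarz)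
  also have "\<dots> \<le> norm (adjoint A y) * norm y" by (intro mult_right_mono norm_A_le) auto
  finally show ?thesis by (cases "adjoint A y = 0") auto
qed

sublocale T: positive_contraction T
proof (rule positive_contraction.intro)
  show "norm (T x) \<le> norm x" for x
    unfolding T_def o_def by (rule order_trans[OF norm_adjoint_le norm_A_le])
  show "T x \<bullet> y = x \<bullet> T y" for x y by (metis inner_T inner_commute)
qed (rule bounded_linear_T, simp add: inner_T)

sublocale S: positive_contraction S
proof (rule positive_contraction.intro)
  show "norm (S x) \<le> norm x" for x
    unfolding S_def o_def by (rule order_trans[OF norm_A_le norm_adjoint_le])
  show "S x \<bullet> y = x \<bullet> S y" for x y by (metis inner_S inner_commute)
qed (rule bounded_linear_S, simp add: inner_S)

lemma A_poly_op: "A (poly_op p T x) = poly_op p S (A x)"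
  by (rule poly_op_intertwine[OF linear_A(1) S.linear T.linear]) (simp add: T_def S_def)

lemma adjoint_poly_op: "adjoint A (poly_op p S y) = poly_op p T (adjoint A y)"
  by (rule poly_op_intertwine[OF linear_A(2) T.linear S.linear]) (simp add: T_def S_def)


lemma nesterov_eq_filter: "nesterov A \<alpha> y k = poly_op (nesterov_filter \<alpha> k) T (adjoint A y)"
proof (induction k rule: induct_nat_012)
  case (ge2 k)
  have TA: "adjoint A (A x) = T x" for x by (simp add: T_def)
  show ?case
    by (simp add: ge2 Let_def T.linear linear_diff[OF linear_A(2)] TA algebra_simps del: minus_pCons)
qed simp_all

lemma nesterov_residual_eq:
  "A (nesterov A \<alpha> y k) - y = - poly_op (nesterov_residual \<alpha> k) S y"
proof -
  have "A (nesterov A \<alpha> y k) = poly_op (nesterov_filter \<alpha> k) S (S y)"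
    unfolding nesterov_eq_filter A_poly_op by (simp add: S_def)
  also have "\<dots> = S (poly_op (nesterov_filter \<alpha> k) S y)"
    by (rule poly_op_intertwine[symmetric]) (auto simp: S.linear)
  finally show ?thesis by (simp add: nesterov_residual_def S.linear)
qed

lemma nesterov_error_eq:
  "nesterov A \<alpha> y k - x =
    adjoint A (poly_op (nesterov_filter \<alpha> k) S (y - A x)) - poly_op (nesterov_residual \<alpha> k) T x"
proof -
  have "poly_op (nesterov_filter \<alpha> k) T (adjoint A (A x)) = T (poly_op (nesterov_filter \<alpha> k) T x)"
    unfolding T_def[symmetric] o_apply[of "adjoint A" A, symmetric]
    by (rule poly_op_intertwine[symmetric]) (auto simp: T.linear)
  then have "adjoint A (poly_op (nesterov_filter \<alpha> k) S (A x)) = T (poly_op (nesterov_filter \<alpha> k) T x)"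
    by (simp add: adjoint_poly_op)
  then show ?thesis
    unfolding nesterov_eq_filter adjoint_poly_op[symmetric]
    by (simp add: nesterov_residual_def T.linear linear_diff[OF linear_A(2)]
        linear_diff[OF bounded_linear.linear[OF bounded_linear_poly_op[OF bounded_linear_S]]])
qed

text \<open>
  The noise contributes $r_k(AA^*)(Ax - y)$, which $|r_k| \le 1$ bounds by the noise level.  The first
  inequality makes the stopping index exist and bounds it, the second one is used at the stopping index.
\<close>

lemma nesterov_discrepancy_le:
  fixes \<beta> :: real
  assumes "\<beta> > -1"
  defines "\<alpha> \<equiv> nesterov_weight \<beta>"
  shows "norm (A (nesterov A \<alpha> y k) - y) \<le> norm (A (poly_op (nesterov_residual \<alpha> k) T x)) + norm (A x - y)"
    and "norm (A (poly_op (nesterov_residual \<alpha> k) T x)) \<le> norm (A (nesterov A \<alpha> y k) - y) + norm (A x - y)"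
proof -
  define r where "r = nesterov_residual \<alpha> k"
  have lin: "linear (poly_op r S)" by (rule bounded_linear.linear[OF bounded_linear_poly_op[OF bounded_linear_S]])
  have "A (nesterov A \<alpha> y k) - y = poly_op r S (A x - y) - A (poly_op r T x)"
    unfolding nesterov_residual_eq A_poly_op r_def[symmetric] by (simp add: linear_diff[OF lin])
  moreover have "norm (poly_op r S (A x - y)) \<le> 1 * norm (A x - y)"
    unfolding r_def \<alpha>_def
    by (rule S.norm_poly_op_le_unit_interval) (rule abs_nesterov_residual_le_1[OF assms(1)])
  ultimately show "norm (A (nesterov A \<alpha> y k) - y) \<le> norm (A (poly_op (nesterov_residual \<alpha> k) T x)) + norm (A x - y)"
    "norm (A (poly_op (nesterov_residual \<alpha> k) T x)) \<le> norm (A (nesterov A \<alpha> y k) - y) + norm (A x - y)"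
    using norm_triangle_ineq4[of "poly_op r S (A x - y)" "A (poly_op r T x)"]
      norm_triangle_sub[of "A (poly_op r T x)" "poly_op r S (A x - y)"]
    unfolding r_def[symmetric] by (simp_all add: norm_minus_commute)
qed

text \<open>
  The noise contributes $A^* g_k(AA^*)(y - Ax)$, whose squared norm is the form of $t\,g_k(t)^2 \le (2k)^2$.
\<close>

lemma nesterov_error_le:
  fixes \<beta> :: real
  assumes "\<beta> > -1"
  defines "\<alpha> \<equiv> nesterov_weight \<beta>"
  shows "norm (nesterov A \<alpha> y k - x) \<le>
    norm (poly_op (nesterov_residual \<alpha> k) T x) + 2 * real k * norm (A x - y)"
proof -
  define g e where "g = poly_op (nesterov_filter \<alpha> k) S (y - A x)" and "e = y - A x"
  have "S g \<bullet> g \<le> (2 * real k)\<^sup>2 * (e \<bullet> e)"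
    unfolding g_def e_def \<alpha>_def
    by (rule S.poly_op_quadratic_form_le) (rule nesterov_filter_bound[OF assms(1)])
  then have "(norm (adjoint A g))\<^sup>2 \<le> (2 * real k * norm e)\<^sup>2"
    by (simp add: inner_S power2_norm_eq_inner power_mult_distrib)
  then have "norm (adjoint A g) \<le> 2 * real k * norm e" by (rule power2_le_imp_le) simp
  then show ?thesis
    using norm_triangle_ineq4[of "adjoint A g" "poly_op (nesterov_residual \<alpha> k) T x"]
    unfolding nesterov_error_eq g_def[symmetric] by (simp add: e_def norm_minus_commute)
qed


section \<open>Rates of the discrepancy principle\<close>

text \<open>
  Both regimes of the theorem at once: the exponent $p$ is the decay rate of
  $\|A r_k(T) x^\dagger\|$.
\<close>

lemma discrepancy_principle_rates:
  fixes \<beta> \<mu> \<tau> :: real and xdag \<omega> :: 'a and ydelta :: "real \<Rightarrow> 'b"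
  assumes \<beta>: "\<beta> > -1" and \<mu>: "\<mu> > 0" and \<tau>: "\<tau> > 1"
    and source: "xdag = op_powr T \<mu> \<omega>"
    and noise: "\<And>\<delta>. \<delta> > 0 \<Longrightarrow> norm (A xdag - ydelta \<delta>) = \<delta>"
  defines "p \<equiv> min (2 * \<mu> + 1) (\<mu> + 1/2 + (\<beta> + 1) / 4)"
    and "x \<equiv> \<lambda>\<delta>. nesterov A (nesterov_weight \<beta>) (ydelta \<delta>)"
  defines "K \<equiv> \<lambda>\<delta>. discrepancy_index A (x \<delta>) (ydelta \<delta>) (\<tau> * \<delta>)"
  shows "\<And>\<delta>. \<delta> > 0 \<Longrightarrow> \<exists>k. norm (A (x \<delta> k) - ydelta \<delta>) \<le> \<tau> * \<delta>"
    and "\<exists>C. \<forall>\<delta>. 0 < \<delta> \<and> \<delta> \<le> 1 \<longrightarrow> real (K \<delta>) \<le> C * \<delta> powr (- (1 / p)) \<and>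
      norm (x \<delta> (K \<delta>) - xdag) \<le> C * \<delta> powr (1 - 1 / p)"
proof -
  define r where "r k = poly_op (nesterov_residual (nesterov_weight \<beta>) k) T xdag" for k
  have "2 * \<mu> + 1 > 0" "\<mu> + 1/2 + (\<beta> + 1) / 4 > 0"
    using \<beta> \<mu> by (auto intro!: add_pos_pos)
  then have p: "p > 0" "p \<le> 2 * \<mu> + 1" unfolding p_def by (simp_all only: min_less_iff_conj min.cobounded1)
  have p': "p = min (2 * (\<mu> + 1/2)) ((\<mu> + 1/2) + (\<beta> + 1) / 4)" by (simp add: p_def)
  obtain C0 where C0: "C0 > 0" and decay: "\<And>k t. k \<ge> 1 \<Longrightarrow> 0 \<le> t \<Longrightarrow> t \<le> 1 \<Longrightarrow>
      t powr (\<mu> + 1/2) * \<bar>poly (nesterov_residual (nesterov_weight \<beta>) k) t\<bar> \<le> C0 * real k powr (- p)"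
    unfolding p' using nesterov_residual_decay[OF \<beta>, of "\<mu> + 1/2"] \<mu> by auto
  define C1 where "C1 = C0 * norm \<omega>"
  have C1: "C1 \<ge> 0" using C0 by (simp add: C1_def)
  have Ar: "norm (A (r k)) \<le> C1 * real k powr (- p)" if "k \<ge> 1" for k
  proof (rule power2_le_imp_le)
    have "T (r k) \<bullet> r k \<le> (C0 * real k powr (- p))\<^sup>2 * (\<omega> \<bullet> \<omega>)"
      unfolding r_def source by (rule T.source_condition_decay[OF \<mu> decay[OF that]])
    then show "(norm (A (r k)))\<^sup>2 \<le> (C1 * real k powr (- p))\<^sup>2"
      by (simp add: inner_T C1_def power_mult_distrib power2_norm_eq_inner mult_ac)
  qed (use C1 in simp)
  have disc: "norm (A (x \<delta> k) - ydelta \<delta>) \<le> norm (A (r k)) + \<delta>"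
    "norm (A (r k)) \<le> norm (A (x \<delta> k) - ydelta \<delta>) + \<delta>" if "\<delta> > 0" for \<delta> k
    using nesterov_discrepancy_le[OF \<beta>, where y = "ydelta \<delta>" and k = k and x = xdag] noise[OF that]
    by (simp_all add: x_def r_def)
  show ex: "\<exists>k. norm (A (x \<delta> k) - ydelta \<delta>) \<le> \<tau> * \<delta>" if \<delta>: "\<delta> > 0" for \<delta>
  proof -
    have "(\<lambda>k. C1 * real k powr (- p)) \<longlonglongrightarrow> C1 * 0"
      using p by (intro tendsto_mult_left tendsto_neg_powr filterlim_real_sequentially) simp
    then have "\<forall>\<^sub>F k in sequentially. C1 * real k powr (- p) < (\<tau> - 1) * \<delta>"
      using \<tau> \<delta> by (intro order_tendstoD(2)[of _ "C1 * 0"]) simp_all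
    then obtain N where N: "\<And>k. k \<ge> N \<Longrightarrow> C1 * real k powr (- p) < (\<tau> - 1) * \<delta>"
      by (auto simp: eventually_at_top_linorder)
    define k where "k = Suc N"
    have "norm (A (x \<delta> k) - ydelta \<delta>) \<le> C1 * real k powr (- p) + \<delta>"
      using disc(1)[OF \<delta>, of k] Ar[of k] by (simp add: k_def)
    also have "\<dots> \<le> (\<tau> - 1) * \<delta> + \<delta>" using N[of k] by (simp add: k_def)
    also have "\<dots> = \<tau> * \<delta>" by (simp add: left_diff_distrib)
    finally show ?thesis by blast
  qed
  define C2 where "C2 = 1 + (C1 / (\<tau> - 1)) powr (1 / p)"
  have C2: "C2 \<ge> 0" by (simp add: C2_def)
  have K_le: "real (K \<delta>) \<le> C2 * \<delta> powr (- (1 / p))" if \<delta>: "0 < \<delta>" "\<delta> \<le> 1" for \<delta>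
  proof -
    have one: "1 \<le> \<delta> powr (- (1 / p))" using \<delta> p powr_mono'[of "- (1 / p)" 0 \<delta>] by simp
    show ?thesis
    proof (cases "K \<delta> \<le> 1")
      case True
      have "1 * 1 \<le> C2 * \<delta> powr (- (1 / p))" using one by (intro mult_mono) (auto simp: C2_def)
      with True show ?thesis by simp
    next
      case False
      define k where "k = K \<delta> - 1"
      have k: "k \<ge> 1" "K \<delta> = Suc k" using False by (auto simp: k_def)
      have "\<not> norm (A (x \<delta> k) - ydelta \<delta>) \<le> \<tau> * \<delta>"
        using k(2) unfolding K_def discrepancy_index_def by (intro not_less_Least) simp
      then have "\<tau> * \<delta> < C1 * real k powr (- p) + \<delta>" using disc(1)[OF \<delta>(1), of k] Ar[OF k(1)] by linarith
      then have "(\<tau> - 1) * \<delta> \<le> C1 * real k powr (- p)" by (simp add: left_diff_distrib)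
      then have "(\<tau> - 1) * \<delta> * real k powr p \<le> C1"
        using k(1) by (simp add: powr_minus field_simps)
      then have "real k powr p \<le> C1 / (\<tau> - 1) / \<delta>"
        using \<tau> \<delta> by (simp add: field_simps)
      then have "(real k powr p) powr (1 / p) \<le> (C1 / (\<tau> - 1) / \<delta>) powr (1 / p)"
        using p by (intro powr_mono2) auto
      then have "real k \<le> (C1 / (\<tau> - 1)) powr (1 / p) * \<delta> powr (- (1 / p))"
        using p k by (simp add: powr_powr powr_divide powr_mult powr_minus_divide)
      with one have "real k + 1 \<le> (C1 / (\<tau> - 1)) powr (1 / p) * \<delta> powr (- (1 / p)) + \<delta> powr (- (1 / p))"
        by linarith
      then show ?thesis by (simp add: k(2) C2_def algebra_simps)
    qed
  qed
  define C3 where "C3 = sqrt ((\<tau> + 1)\<^sup>2 + (norm \<omega>)\<^sup>2) + 2 * C2"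
  have err: "norm (x \<delta> (K \<delta>) - xdag) \<le> C3 * \<delta> powr (1 - 1 / p)" if \<delta>: "0 < \<delta>" "\<delta> \<le> 1" for \<delta>
  proof -
    define k where "k = K \<delta>"
    \<comment> \<open>This choice balances the two terms of the interpolation inequality:
      both become multiples of the square of \<open>\<delta> powr \<theta>\<close>.\<close>
    define \<epsilon> where "\<epsilon> = \<delta> powr (2 / (2 * \<mu> + 1))"
    define \<theta> where "\<theta> = 2 * \<mu> / (2 * \<mu> + 1)"
    have \<theta>: "\<theta> = 1 - 1 / (2 * \<mu> + 1)"
    proof -
      have "\<theta> = ((2 * \<mu> + 1) - 1) / (2 * \<mu> + 1)" by (simp add: \<theta>_def)
      also have "\<dots> = 1 - 1 / (2 * \<mu> + 1)" using \<mu> unfolding diff_divide_distrib by simp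
      finally show ?thesis .
    qed
    have \<epsilon>: "\<epsilon> > 0" using \<delta> by (simp add: \<epsilon>_def)
    have "norm (A (x \<delta> k) - ydelta \<delta>) \<le> \<tau> * \<delta>"
      unfolding k_def K_def discrepancy_index_def by (rule LeastI_ex[OF ex[OF \<delta>(1)]])
    then have "norm (A (r k)) \<le> (\<tau> + 1) * \<delta>"
      using disc(2)[OF \<delta>(1), of k] by (simp add: distrib_right)
    then have "(norm (A (r k)))\<^sup>2 \<le> ((\<tau> + 1) * \<delta>)\<^sup>2" by (intro power_mono) auto
    then have Tr: "T (r k) \<bullet> r k \<le> (\<tau> + 1)\<^sup>2 * \<delta>\<^sup>2"
      by (simp add: inner_T power2_norm_eq_inner power_mult_distrib)
    have "r k \<bullet> r k \<le> (T (r k) \<bullet> r k) / \<epsilon> + \<epsilon> powr (2 * \<mu>) * (\<omega> \<bullet> \<omega>)"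
      unfolding r_def source
      by (rule T.source_condition_interpolation[OF \<mu> \<epsilon> abs_nesterov_residual_le_1[OF \<beta>]])
    also have "\<dots> \<le> (\<tau> + 1)\<^sup>2 * \<delta>\<^sup>2 / \<epsilon> + \<epsilon> powr (2 * \<mu>) * (\<omega> \<bullet> \<omega>)"
      using Tr \<epsilon> by (intro add_right_mono divide_right_mono) auto
    also have "\<delta>\<^sup>2 / \<epsilon> = (\<delta> powr \<theta>)\<^sup>2"
    proof -
      have "\<delta>\<^sup>2 / \<epsilon> = \<delta> powr (2 - 2 / (2 * \<mu> + 1))"
        using \<delta> by (simp add: \<epsilon>_def powr_diff)
      also have "2 - 2 / (2 * \<mu> + 1) = \<theta> + \<theta>" by (simp add: \<theta>)
      finally show ?thesis by (simp only: power2_eq_square powr_add)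
    qed
    then have "(\<tau> + 1)\<^sup>2 * \<delta>\<^sup>2 / \<epsilon> = (\<tau> + 1)\<^sup>2 * (\<delta> powr \<theta>)\<^sup>2" by (simp only: times_divide_eq_right[symmetric])
    also have "\<epsilon> powr (2 * \<mu>) = (\<delta> powr \<theta>)\<^sup>2"
    proof -
      have "\<epsilon> powr (2 * \<mu>) = \<delta> powr (\<theta> + \<theta>)"
        by (simp add: \<epsilon>_def \<theta>_def powr_powr)
      then show ?thesis by (simp only: power2_eq_square powr_add)
    qed
    also have "(\<tau> + 1)\<^sup>2 * (\<delta> powr \<theta>)\<^sup>2 + (\<delta> powr \<theta>)\<^sup>2 * (\<omega> \<bullet> \<omega>)
        = (sqrt ((\<tau> + 1)\<^sup>2 + (norm \<omega>)\<^sup>2) * \<delta> powr \<theta>)\<^sup>2"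
      by (simp add: power_mult_distrib power2_norm_eq_inner algebra_simps)
    finally have "(norm (r k))\<^sup>2 \<le> (sqrt ((\<tau> + 1)\<^sup>2 + (norm \<omega>)\<^sup>2) * \<delta> powr \<theta>)\<^sup>2"
      unfolding power2_norm_eq_inner[of "r k"] .
    then have "norm (r k) \<le> sqrt ((\<tau> + 1)\<^sup>2 + (norm \<omega>)\<^sup>2) * \<delta> powr \<theta>"
      by (rule power2_le_imp_le) simp
    also have "\<dots> \<le> sqrt ((\<tau> + 1)\<^sup>2 + (norm \<omega>)\<^sup>2) * \<delta> powr (1 - 1 / p)"
    proof (intro mult_left_mono powr_mono')
      have "1 / (2 * \<mu> + 1) \<le> 1 / p" using p by (intro divide_left_mono) auto
      then show "1 - 1 / p \<le> \<theta>" by (simp add: \<theta>)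
    qed (use \<delta> in auto)
    finally have approx: "norm (r k) \<le> sqrt ((\<tau> + 1)\<^sup>2 + (norm \<omega>)\<^sup>2) * \<delta> powr (1 - 1 / p)" .
    have "2 * real k * \<delta> \<le> 2 * (C2 * \<delta> powr (- (1 / p))) * \<delta>"
      unfolding k_def using K_le[OF \<delta>] \<delta> by (intro mult_right_mono mult_left_mono) auto
    also have "\<dots> = 2 * C2 * \<delta> powr (1 - 1 / p)"
      using \<delta> by (simp add: powr_diff powr_minus_divide)
    finally have "2 * real k * \<delta> \<le> 2 * C2 * \<delta> powr (1 - 1 / p)" .
    moreover have "norm (x \<delta> k - xdag) \<le> norm (r k) + 2 * real k * \<delta>"
      using nesterov_error_le[OF \<beta>, where y = "ydelta \<delta>" and k = k and x = xdag] noise[OF \<delta>(1)] by (simp add: x_def r_def)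
    ultimately show ?thesis using approx unfolding k_def C3_def by (simp add: distrib_right)
  qed
  show "\<exists>C. \<forall>\<delta>. 0 < \<delta> \<and> \<delta> \<le> 1 \<longrightarrow> real (K \<delta>) \<le> C * \<delta> powr (- (1 / p)) \<and>
      norm (x \<delta> (K \<delta>) - xdag) \<le> C * \<delta> powr (1 - 1 / p)"
  proof (intro exI[of _ "C2 + C3"] allI impI conjI; elim conjE)
    fix \<delta> :: real assume \<delta>: "0 < \<delta>" "\<delta> \<le> 1"
    have "C3 \<ge> 0" using C2 by (simp add: C3_def)
    then have le: "C2 \<le> C2 + C3" "C3 \<le> C2 + C3" using C2 by auto
    show "real (K \<delta>) \<le> (C2 + C3) * \<delta> powr (- (1 / p))"
      by (rule order_trans[OF K_le[OF \<delta>] mult_right_mono[OF le(1)]]) simp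
    show "norm (x \<delta> (K \<delta>) - xdag) \<le> (C2 + C3) * \<delta> powr (1 - 1 / p)"
      by (rule order_trans[OF err[OF \<delta>] mult_right_mono[OF le(2)]]) simp
  qed
qed

end

lemma bigo_at_right_0_powrI:
  fixes f :: "real \<Rightarrow> real"
  assumes "\<And>\<delta>. 0 < \<delta> \<Longrightarrow> \<delta> \<le> 1 \<Longrightarrow> \<bar>f \<delta>\<bar> \<le> C * \<delta> powr a"
  shows "f \<in> O[at_right 0](\<lambda>\<delta>. \<delta> powr a)"
proof (rule bigoI)
  have "eventually (\<lambda>\<delta>::real. \<delta> \<in> {0<..<1}) (at_right 0)"
    by (rule eventually_at_right_real) simp
  then show "eventually (\<lambda>\<delta>. norm (f \<delta>) \<le> C * norm (\<delta> powr a)) (at_right 0)"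
    by eventually_elim (use assms in auto)
qed

theorem theorem5:
  fixes A :: "'a::{real_inner,complete_space} \<Rightarrow> 'b::{real_inner,complete_space}"
    and \<beta> \<mu> \<tau> :: real
    and xdag \<omega> :: 'a
    and y :: 'b
    and ydelta :: "real \<Rightarrow> 'b"
    and x :: "real \<Rightarrow> nat \<Rightarrow> 'a"
    and kdelta :: "real \<Rightarrow> nat"
  assumes "bounded_linear A"
    and "onorm (adjoint A \<circ> A) < 1"
    and "\<beta> > -1"
    and "min_norm_solution A y xdag"
    and "\<mu> > 0"
    and "xdag = op_powr (adjoint A \<circ> A) \<mu> \<omega>"
    and "\<And>\<delta>. \<delta> > 0 \<Longrightarrow> norm (A xdag - ydelta \<delta>) = \<delta>"
    and "\<tau> > 1"
    and "\<And>\<delta>. x \<delta> = nesterov A (nesterov_weight \<beta>) (ydelta \<delta>)"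
    and "\<And>\<delta>. kdelta \<delta> = discrepancy_index A (x \<delta>) (ydelta \<delta>) (\<tau> * \<delta>)"
  shows "(\<forall>\<delta>>0. \<exists>k. norm (A (x \<delta> k) - ydelta \<delta>) \<le> \<tau> * \<delta>) \<and>
    (\<mu> + 1/2 \<le> (\<beta> + 1) / 4 \<longrightarrow>
      (\<lambda>\<delta>. norm (x \<delta> (kdelta \<delta>) - xdag)) \<in> O[at_right 0](\<lambda>\<delta>. \<delta> powr (2 * \<mu> / (2 * \<mu> + 1))) \<and>
      (\<lambda>\<delta>. real (kdelta \<delta>)) \<in> O[at_right 0](\<lambda>\<delta>. \<delta> powr (- (1 / (2 * \<mu> + 1))))) \<and>
    (\<mu> + 1/2 \<ge> (\<beta> + 1) / 4 \<longrightarrow>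
      (\<lambda>\<delta>. real (kdelta \<delta>))
        \<in> O[at_right 0](\<lambda>\<delta>. \<delta> powr (- (1 / (1/2 + \<mu> + (\<beta> + 1) / 4)))) \<and>
      (\<lambda>\<delta>. norm (x \<delta> (kdelta \<delta>) - xdag))
        \<in> O[at_right 0](\<lambda>\<delta>. \<delta> powr ((\<mu> + (\<beta> + 1) / 4 - 1/2) / (\<mu> + (\<beta> + 1) / 4 + 1/2))))"
proof -
  interpret contractive_normal_operator A
    by (rule contractive_normal_operator.intro) (fact assms)+
  have T: "adjoint A \<circ> A = T" by (simp add: T_def)
  have x: "x = (\<lambda>\<delta>. nesterov A (nesterov_weight \<beta>) (ydelta \<delta>))"
    using assms(9) by auto
  have K: "kdelta = (\<lambda>\<delta>. discrepancy_index A (nesterov A (nesterov_weight \<beta>) (ydelta \<delta>)) (ydelta \<delta>) (\<tau> * \<delta>))"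
    using assms(10) by (auto simp: x)
  define p where "p = min (2 * \<mu> + 1) (\<mu> + 1/2 + (\<beta> + 1) / 4)"
  note rates = discrepancy_principle_rates[OF assms(3,5,8) assms(6)[unfolded T] assms(7),
      folded p_def, folded K, folded x]
  from rates(2) obtain C where C:
    "\<And>\<delta>. 0 < \<delta> \<Longrightarrow> \<delta> \<le> 1 \<Longrightarrow> real (kdelta \<delta>) \<le> C * \<delta> powr (- (1 / p))"
    "\<And>\<delta>. 0 < \<delta> \<Longrightarrow> \<delta> \<le> 1 \<Longrightarrow> norm (x \<delta> (kdelta \<delta>) - xdag) \<le> C * \<delta> powr (1 - 1 / p)"
    unfolding x K by blast
  have index: "(\<lambda>\<delta>. real (kdelta \<delta>)) \<in> O[at_right 0](\<lambda>\<delta>. \<delta> powr (- (1 / p)))"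
    by (rule bigo_at_right_0_powrI[of _ C]) (use C(1) in simp)
  have error: "(\<lambda>\<delta>. norm (x \<delta> (kdelta \<delta>) - xdag)) \<in> O[at_right 0](\<lambda>\<delta>. \<delta> powr (1 - 1 / p))"
    by (rule bigo_at_right_0_powrI[of _ C]) (use C(2) in simp)
  have exponent: "1 - 1 / q = (q - 1) / q" if "q > 0" for q :: real
    using that by (simp add: diff_divide_distrib)
  show ?thesis
  proof (intro conjI impI)
    show "\<forall>\<delta>>0. \<exists>k. norm (A (x \<delta> k) - ydelta \<delta>) \<le> \<tau> * \<delta>"
      using rates(1) unfolding x by blast
  next
    assume "\<mu> + 1/2 \<le> (\<beta> + 1) / 4"
    then have "2 * \<mu> + 1 \<le> \<mu> + 1/2 + (\<beta> + 1) / 4" by linarith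
    then have p: "p = 2 * \<mu> + 1" unfolding p_def by (rule min_absorb1)
    show "(\<lambda>\<delta>. real (kdelta \<delta>)) \<in> O[at_right 0](\<lambda>\<delta>. \<delta> powr (- (1 / (2 * \<mu> + 1))))"
      using index unfolding p .
    have "1 - 1 / p = 2 * \<mu> / (2 * \<mu> + 1)"
      using assms(5) exponent[of p] by (simp add: p)
    with error show "(\<lambda>\<delta>. norm (x \<delta> (kdelta \<delta>) - xdag))
        \<in> O[at_right 0](\<lambda>\<delta>. \<delta> powr (2 * \<mu> / (2 * \<mu> + 1)))" by (simp only:)
  next
    assume "\<mu> + 1/2 \<ge> (\<beta> + 1) / 4"
    then have "\<mu> + 1/2 + (\<beta> + 1) / 4 \<le> 2 * \<mu> + 1" by linarith
    then have p: "p = 1/2 + \<mu> + (\<beta> + 1) / 4" unfolding p_def by (simp add: min_absorb2)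
    show "(\<lambda>\<delta>. real (kdelta \<delta>)) \<in> O[at_right 0](\<lambda>\<delta>. \<delta> powr (- (1 / (1/2 + \<mu> + (\<beta> + 1) / 4))))"
      using index unfolding p .
    have "p > 0" using assms(3,5) unfolding p by (auto intro!: add_pos_pos)
    moreover have "p - 1 = \<mu> + (\<beta> + 1) / 4 - 1/2" "p = \<mu> + (\<beta> + 1) / 4 + 1/2" by (simp_all add: p)
    ultimately have "1 - 1 / p = (\<mu> + (\<beta> + 1) / 4 - 1/2) / (\<mu> + (\<beta> + 1) / 4 + 1/2)"
      using exponent[of p] by simp
    with error show "(\<lambda>\<delta>. norm (x \<delta> (kdelta \<delta>) - xdag))
        \<in> O[at_right 0](\<lambda>\<delta>. \<delta> powr ((\<mu> + (\<beta> + 1) / 4 - 1/2) / (\<mu> + (\<beta> + 1) / 4 + 1/2)))" by (simp only:)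
  qed
qed

end
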